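(* Let $a_1,a_2,a_3,c_1,c_2,c_3$ be positive integers with $$\frac{1+a_1a_2}{1+c_1c_2}>\frac{a_1+a_3+a_1a_2a_3}{c_1+c_3+c_1c_2c_3},$$ and let $R$ be a positive rational tangle. Then the crossing number of the (quasi-alternating) Montesinos link $L=L(a_1a_2a_3,\,R,\,(-c_1)(-c_2)(-c_3))$ is at most its determinant, i.e. $c(L)\le\det(L)$.
   Context: $c(L)$ is the crossing number of a link $L\subset S^3$ and $\det(L)=|\Delta_L(-1)|$ its determinant. Quasi-alternating links: the set $\mathcal{Q}$ of quasi-alternating links is the smallest set of links such that (i) the unknot belongs to $\mathcal{Q}$; (ii) if $L$ is a link with a diagram containing a crossing $x$ such that both smoothings $L_0,L_1$ of the diagram at $x$ belong to $\mathcal{Q}$, $\det(L_0),\det(L_1)\ge 1$, and $\det(L)=\det(L_0)+\det(L_1)$, then $L\in\mathcal{Q}$. The links $L$ in the claim are known to be quasi-alternating. Rational tangles: for $r\in\mathbb{Q}$ let $T(r)$ be the rational tangle of slope $r$, normalized so that $T(1)$ is a fixed single (positive) crossing, $T(k)$ for an integer $k\geq 1$ is a horizontal row of $k$ such crossings, $T(1/k)$ is a vertical column of $k$ such crossings, $T(r+1)$ is the horizontal sum of $T(r)$ and $T(1)$, and $T(-r)$ is the mirror image of $T(r)$. A positive rational tangle is $T(r)$ with $r\in\mathbb{Q}$, $r>0$. Conway notation for the outer tangles: $a_1a_2a_3$ denotes the rational tangle of slope $\dfrac{1}{a_3+\frac{1}{a_2+\frac1{a_1}}}=\dfrac{1+a_1a_2}{a_1+a_3+a_1a_2a_3}$,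 and $(-c_1)(-c_2)(-c_3)$ denotes the rational tangle of slope $-\dfrac{1+c_1c_2}{c_1+c_3+c_1c_2c_3}$. Montesinos links: $L(A,R,B)$ is the link obtained by taking the horizontal sum of the three rational tangles $A,R,B$ in this order and forming its numerator closure (joining the two top endpoints to each other and the two bottom endpoints to each other). For slopes $\beta_i/\alpha_i$ ($i=1,2,3$) in lowest terms its determinant is $\left|\alpha_1\alpha_2\alpha_3\sum_i\beta_i/\alpha_i\right|$. *)

theory Defs
  imports "Jordan_Normal_Form.Determinant" "HOL-Computational_Algebra.Polynomial"
begin

section \<open>Tangle and link diagrams\<close>

text \<open>
  Diagrams are in Morse position with respect to the height function: a diagram is the list, from
  bottom to top, of its critical levels.  The level \<open>(p, i)\<close> has the elementary piece \<open>p\<close> with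
  exactly \<open>i\<close> vertical strands to the left of it.  A \<open>Cup\<close> is a local minimum, a \<open>Cap\<close> a local
  maximum.  In \<open>Cross True\<close> the overstrand runs from bottom left to top right, in \<open>Cross False\<close>
  from bottom right to top left.  Every such list is planar by construction, and every link
  diagram is planar isotopic to one of this form.
\<close>

datatype piece = Cup | Cap | Cross bool

type_synonym diagram = "(piece \<times> nat) list"

fun ins :: "piece \<Rightarrow> nat" where
  "ins Cup = 0"
| "ins Cap = 2"
| "ins (Cross s) = 2"

fun outs :: "piece \<Rightarrow> nat" where
  "outs Cup = 2"
| "outs Cap = 0"
| "outs (Cross s) = 2"

text \<open>\<open>is_tangle m w n\<close>: the list \<open>w\<close> is a tangle diagram with \<open>m\<close> endpoints at the bottom and \<open>n\<close>
  at the top.\<close>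

fun is_tangle :: "nat \<Rightarrow> diagram \<Rightarrow> nat \<Rightarrow> bool" where
  "is_tangle m [] n \<longleftrightarrow> m = n"
| "is_tangle m ((p, i) # w) n \<longleftrightarrow> i + ins p \<le> m \<and> is_tangle (m - ins p + outs p) w n"

definition link_diagram :: "diagram \<Rightarrow> bool" where
  "link_diagram w \<longleftrightarrow> is_tangle 0 w 0"

definition crossings :: "diagram \<Rightarrow> nat" where
  "crossings w = length (filter (\<lambda>(p, i). \<exists>s. p = Cross s) w)"


section \<open>Isotopy and crossing number\<close>

text \<open>
  The moves relating Morse diagrams of isotopic unoriented links (Freyd--Yetter, Turaev):
  \<open>zigzag\<close>, \<open>slide\<close> and \<open>exchange\<close> generate planar isotopy, and the others are the Reidemeister
  moves.  The remaining variants of the third Reidemeister move follow from the one listed and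
  the second.  The relation is symmetrised in \<open>isotopic\<close>.
\<close>

inductive local_move :: "diagram \<Rightarrow> diagram \<Rightarrow> bool" where
  zigzag_left: "local_move [(Cup, i), (Cap, Suc i)] []"
| zigzag_right: "local_move [(Cup, Suc i), (Cap, i)] []"
| slide_cap: "local_move [(Cross s, i), (Cap, Suc i)] [(Cross (\<not> s), Suc i), (Cap, i)]"
| slide_cup: "local_move [(Cup, i), (Cross s, Suc i)] [(Cup, Suc i), (Cross (\<not> s), i)]"
| exchange: "i + outs p \<le> j \<Longrightarrow>
    local_move [(p, i), (q, j)] [(q, j - outs p + ins p), (p, i)]"
| reidemeister1_cup: "local_move [(Cup, i), (Cross s, i)] [(Cup, i)]"
| reidemeister1_cap: "local_move [(Cross s, i), (Cap, i)] [(Cap, i)]"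
| reidemeister2: "local_move [(Cross s, i), (Cross (\<not> s), i)] []"
| reidemeister3: "local_move [(Cross s, i), (Cross s, Suc i), (Cross s, i)]
    [(Cross s, Suc i), (Cross s, i), (Cross s, Suc i)]"

inductive diagram_move :: "diagram \<Rightarrow> diagram \<Rightarrow> bool" where
  "local_move a b \<Longrightarrow> link_diagram (u @ a @ v) \<Longrightarrow> link_diagram (u @ b @ v) \<Longrightarrow>
    diagram_move (u @ a @ v) (u @ b @ v)"

definition isotopic :: "diagram \<Rightarrow> diagram \<Rightarrow> bool" where
  "isotopic = equivclp diagram_move"

text \<open>The crossing number of the link presented by \<open>D\<close>.\<close>

definition crossing_number :: "diagram \<Rightarrow> nat" where
  "crossing_number D = (LEAST n. \<exists>D'. isotopic D D' \<and> crossings D' = n)"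


section \<open>Alexander polynomial and determinant\<close>

text \<open>
  The diagram is read from bottom to top.  A fresh generator is introduced by every \<open>Cup\<close> and by
  the outgoing understrand of every crossing, so that the generators are the arcs of the Wirtinger
  presentation, except that an arc passing over a maximum may carry a different generator
  on each side, and these are identified by the relation of the \<open>Cap\<close>.  The state \<open>(st, n)\<close> at a
  level consists of the list \<open>st\<close> of the strands there, each given by its generator and by
  whether it is oriented upwards, and the number \<open>n\<close> of generators used so far.

  An orientation of the diagram is encoded by \<open>orient\<close>: for a generator \<open>g\<close> introduced by a \<open>Cup\<close>, the
  left end of the \<open>Cup\<close> points upwards iff \<open>orient g\<close>.
\<close>

type_synonym state = "(nat \<times> bool) list \<times> nat"

fun advance :: "(nat \<Rightarrow> bool) \<Rightarrow> state \<Rightarrow> piece \<times> nat \<Rightarrow> state" where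
  "advance orient (st, n) (Cup, i) =
    (take i st @ [(n, orient n), (n, \<not> orient n)] @ drop i st, Suc n)"
| "advance orient (st, n) (Cap, i) = (take i st @ drop (i + 2) st, n)"
| "advance orient (st, n) (Cross s, i) =
    (let x = st ! i; y = st ! Suc i in
     (take i st @ (if s then [(n, snd y), x] else [y, (n, snd x)]) @ drop (i + 2) st, Suc n))"

text \<open>\<open>orient\<close> is an orientation of the diagram iff at each \<open>Cap\<close> one end points upwards and the
  other one downwards.\<close>

fun oriented_from :: "(nat \<Rightarrow> bool) \<Rightarrow> state \<Rightarrow> diagram \<Rightarrow> bool" where
  "oriented_from orient S [] \<longleftrightarrow> True"
| "oriented_from orient S ((p, i) # w) \<longleftrightarrow>
    (p = Cap \<longrightarrow> snd (fst S ! i) \<noteq> snd (fst S ! Suc i)) \<and>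
    oriented_from orient (advance orient S (p, i)) w"

definition orientation :: "diagram \<Rightarrow> (nat \<Rightarrow> bool) \<Rightarrow> bool" where
  "orientation D orient \<longleftrightarrow> oriented_from orient ([], 0) D"

definition linear_form :: "('a :: comm_ring_1 \<times> nat) list \<Rightarrow> nat \<Rightarrow> 'a" where
  "linear_form cs k = (\<Sum>(c, g)\<leftarrow>cs. if g = k then c else 0)"

text \<open>The variable \<open>t\<close> of the Alexander polynomial is \<open>[:0, 1:]\<close>.  If \<open>over\<close> is the overstrand of
  a crossing and \<open>left\<close>, \<open>right\<close> are the parts of the understrand on the left and on the right of the
  oriented overstrand, the crossing contributes the relation \<open>(1 - t) over + t left - right = 0\<close>.\<close>

definition crossing_relation :: "nat \<Rightarrow> nat \<Rightarrow> nat \<Rightarrow> nat \<Rightarrow> int poly" where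
  "crossing_relation over left right =
    linear_form [([:1, -1:], over), ([:0, 1:], left), (-1, right)]"

fun piece_relations :: "state \<Rightarrow> piece \<times> nat \<Rightarrow> (nat \<Rightarrow> int poly) list" where
  "piece_relations (st, n) (Cup, i) = []"
| "piece_relations (st, n) (Cap, i) = [linear_form [(1, fst (st ! i)), (-1, fst (st ! Suc i))]]"
| "piece_relations (st, n) (Cross s, i) =
    (let (a, a_up) = st ! i; (b, b_up) = st ! Suc i in
     [if s then (if a_up then crossing_relation a n b else crossing_relation a b n)
      else (if b_up then crossing_relation b a n else crossing_relation b n a)])"

fun relations_from ::
    "(nat \<Rightarrow> bool) \<Rightarrow> state \<Rightarrow> diagram \<Rightarrow> (nat \<Rightarrow> int poly) list" where
  "relations_from orient S [] = []"
| "relations_from orient S (l # w) =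
    piece_relations S l @ relations_from orient (advance orient S l) w"

text \<open>A link diagram has as many cups as caps, hence as many relations as generators.\<close>

definition alexander_matrix :: "diagram \<Rightarrow> (nat \<Rightarrow> bool) \<Rightarrow> int poly mat" where
  "alexander_matrix D orient =
    (let rels = relations_from orient ([], 0) D; n = length rels
     in mat n n (\<lambda>(i, j). (rels ! i) j))"

text \<open>The Alexander polynomial is only determined up to a unit \<open>t^k\<close> or \<open>-t^k\<close>, and deleting another
  row or column changes the result by such a unit.  Here the last row and the first column are
  deleted.\<close>

definition alexander_poly :: "diagram \<Rightarrow> (nat \<Rightarrow> bool) \<Rightarrow> int poly" where
  "alexander_poly D orient =
    det (mat_delete (alexander_matrix D orient) (dim_row (alexander_matrix D orient) - 1) 0)"

text \<open>The determinant of an unoriented link is computed from any orientation; that the choice is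
  immaterial is the lemma \<open>link_det_eq\<close> below.\<close>

definition link_det :: "diagram \<Rightarrow> int" where
  "link_det D = \<bar>poly (alexander_poly D (SOME orient. orientation D orient)) (-1)\<bar>"

lemma poly_linear_form:
  "poly (linear_form cs k) x = linear_form (map (\<lambda>(c, g). (poly c x, g)) cs) k"
  unfolding linear_form_def by (induction cs) auto

lemma relations_at_minus_one:
  assumes "map fst st = map fst st'" "is_tangle (length st) w m"
  shows "map (\<lambda>r k. poly (r k) (-1)) (relations_from orient (st, n) w) =
    map (\<lambda>r k. poly (r k) (-1)) (relations_from orient' (st', n) w)"
  using assms
proof (induction w arbitrary: st st' n)
  case Nil
  then show ?case by simp
next
  case (Cons l w)
  obtain p i where l: "l = (p, i)" by force
  have len: "length st' = length st"
    using Cons.prems(1) by (metis length_map)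
  have fst_nth: "fst (st ! k) = fst (st' ! k)" if "k < length st" for k
    using that Cons.prems(1) len by (metis nth_map)
  have fst_take: "map fst (take k st) = map fst (take k st')"
    and fst_drop: "map fst (drop k st) = map fst (drop k st')" for k
    using Cons.prems(1) by (metis take_map, metis drop_map)
  obtain st1 st1' n1 where
    adv: "advance orient (st, n) l = (st1, n1)" "advance orient' (st', n) l = (st1', n1)"
    using l by (cases p) (auto simp: Let_def)
  have bound: "i + ins p \<le> length st"
    using Cons.prems(2) l by simp
  have "map fst st1 = map fst st1'"
    using adv l bound fst_take fst_drop fst_nth by (cases p) (auto simp: Let_def)
  moreover have "length st1 = length st - ins p + outs p"
    using adv l bound by (cases p) (auto simp: Let_def)
  moreover have "is_tangle (length st - ins p + outs p) w m"
    using Cons.prems(2) unfolding l is_tangle.simps by (rule conjunct2)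
  ultimately have IH: "map (\<lambda>r k. poly (r k) (-1)) (relations_from orient (st1, n1) w) =
    map (\<lambda>r k. poly (r k) (-1)) (relations_from orient' (st1', n1) w)"
    by (intro Cons.IH) metis+
  have "map (\<lambda>r k. poly (r k) (-1)) (piece_relations (st, n) l) =
    map (\<lambda>r k. poly (r k) (-1)) (piece_relations (st', n) l)"
  proof (cases p)
    case (Cross s)
    then show ?thesis
      using l bound fst_nth[of i] fst_nth[of "Suc i"]
      by (auto simp: crossing_relation_def poly_linear_form split: prod.splits)
        (auto simp: linear_form_def)
  qed (use l bound fst_nth[of i] fst_nth[of "Suc i"] in auto)
  with IH adv show ?case by simp
qed

lemma link_det_eq:
  assumes "link_diagram D"
  shows "link_det D = \<bar>poly (alexander_poly D orient) (-1)\<bar>"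
proof -
  interpret ev: comm_ring_hom "\<lambda>q :: int poly. poly q (-1)"
    by unfold_locales auto
  have "map_mat (\<lambda>q. poly q (-1)) (alexander_matrix D orient) =
    map_mat (\<lambda>q. poly q (-1)) (alexander_matrix D orient')" for orient orient'
  proof -
    have eq: "map (\<lambda>r k. poly (r k) (-1)) (relations_from orient ([], 0) D) =
      map (\<lambda>r k. poly (r k) (-1)) (relations_from orient' ([], 0) D)"
      using assms by (intro relations_at_minus_one) (auto simp: link_diagram_def)
    hence len: "length (relations_from orient ([], 0) D) =
      length (relations_from orient' ([], 0) D)"
      by (metis length_map)
    have "poly ((relations_from orient ([], 0) D ! i) j) (-1) =
      poly ((relations_from orient' ([], 0) D ! i) j) (-1)"
      if "i < length (relations_from orient' ([], 0) D)" for i j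
      using arg_cong[OF eq, of "\<lambda>rs. (rs ! i) j"] that len by simp
    then show ?thesis
      by (intro eq_matI) (auto simp: alexander_matrix_def Let_def len)
  qed
  moreover have "poly (alexander_poly D orient) (-1) =
    det (mat_delete (map_mat (\<lambda>q. poly q (-1)) (alexander_matrix D orient))
      (dim_row (map_mat (\<lambda>q. poly q (-1)) (alexander_matrix D orient)) - 1) 0)" for orient
  proof -
    have "map_mat (\<lambda>q. poly q (-1)) (mat_delete (alexander_matrix D orient) k 0) =
      mat_delete (map_mat (\<lambda>q. poly q (-1)) (alexander_matrix D orient)) k 0"
      if "k = dim_row (alexander_matrix D orient) - 1" for k
      using that by (intro eq_matI)
        (auto simp: mat_delete_def alexander_matrix_def Let_def)
    then show ?thesis
      by (simp add: alexander_poly_def flip: ev.hom_det)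
  qed
  ultimately show ?thesis
    unfolding link_det_def by metis
qed


section \<open>Rational tangles and Montesinos links\<close>

definition shift :: "nat \<Rightarrow> diagram \<Rightarrow> diagram" where
  "shift k w = map (\<lambda>(p, i). (p, i + k)) w"

definition mirror :: "diagram \<Rightarrow> diagram" where
  "mirror w = map (\<lambda>(p, i). (case p of Cross s \<Rightarrow> Cross (\<not> s) | _ \<Rightarrow> p, i)) w"

text \<open>In the following, \<open>A\<close> and \<open>B\<close> are tangle diagrams with two endpoints at the bottom and two at
  the top.  In \<open>horizontal_sum A B\<close> they are placed side by side, and the two right endpoints
  of \<open>A\<close> are joined to the two left endpoints of \<open>B\<close>; in \<open>vertical_sum A B\<close> the tangle \<open>B\<close> is placed
  on top of \<open>A\<close>.\<close>

definition horizontal_sum :: "diagram \<Rightarrow> diagram \<Rightarrow> diagram" where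
  "horizontal_sum A B = [(Cup, 1)] @ A @ shift 2 B @ [(Cap, 1)]"

definition vertical_sum :: "diagram \<Rightarrow> diagram \<Rightarrow> diagram" where
  "vertical_sum A B = A @ B"

definition numerator_closure :: "diagram \<Rightarrow> diagram" where
  "numerator_closure A = [(Cup, 0)] @ A @ [(Cap, 0)]"

lemma rat_eq_divide:
  obtains p q where "r = of_int p / of_int q" "q > 0" "coprime p q" "quotient_of r = (p, q)"
  by (metis quotient_of_coprime quotient_of_denom_pos quotient_of_div surj_pair)

lemma quotient_of_divide:
  "quotient_of (of_int p / of_int q) = (p, q)" if "q > 0" "coprime p q"
  using that by (simp add: quotient_of_Fract normalize_stable flip: Fract_of_int_quotient)

text \<open>The positive crossing \<open>T(1)\<close> is taken to be \<open>Cross True\<close>.  Since \<open>T(-1)\<close> is its mirror image,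
  the other choice replaces every link by its mirror image.  \<open>rational_tangle r\<close> is the tangle \<open>T(r)\<close>.  For \<open>0 < r < 1\<close> and \<open>s = r / (1 - r)\<close> we
  have \<open>1 / r = 1 / s + 1\<close>, and \<open>T(r)\<close> is the vertical sum of \<open>T(s)\<close> and \<open>T(1)\<close>.  In particular
  \<open>T(1 / (a + 1 / s))\<close> consists of \<open>T(s)\<close> and a vertical column of \<open>a\<close> crossings.\<close>

function rational_tangle :: "rat \<Rightarrow> diagram" where
  "rational_tangle r =
    (if r < 0 then mirror (rational_tangle (- r))
     else if r = 0 then [(Cap, 0), (Cup, 0)]
     else if r = 1 then [(Cross True, 0)]
     else if r > 1 then horizontal_sum (rational_tangle (r - 1)) [(Cross True, 0)]
     else vertical_sum (rational_tangle (r / (1 - r))) [(Cross True, 0)])"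
  by pat_completeness auto
termination
proof (relation "measure (\<lambda>r. let (p, q) = quotient_of r in
    nat (2 * \<bar>p\<bar> + 2 * q + (if p < 0 then 1 else 0)))", goal_cases)
  case 1
  then show ?case by simp
next
  case (2 r)
  obtain p q where r: "r = of_int p / of_int q" "q > 0" "coprime p q" "quotient_of r = (p, q)"
    by (rule rat_eq_divide)
  have "p < 0" using 2 r by (simp add: divide_less_0_iff)
  moreover have "quotient_of (- r) = (- p, q)"
    using r quotient_of_divide[of q "- p"] by simp
  ultimately show ?case using r by simp
next
  case (3 r)
  obtain p q where r: "r = of_int p / of_int q" "q > 0" "coprime p q" "quotient_of r = (p, q)"
    by (rule rat_eq_divide)
  have "q < p" using 3 r by (simp add: less_divide_eq)
  moreover have "r - 1 = of_int (p - q) / of_int q"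
    using r by (simp add: field_simps)
  hence "quotient_of (r - 1) = (p - q, q)"
    using r quotient_of_divide[of q "p - q"] by (simp add: 
      gcd_diff1 coprime_iff_gcd_eq_1)
  ultimately show ?case using r by simp
next
  case (4 r)
  obtain p q where r: "r = of_int p / of_int q" "q > 0" "coprime p q" "quotient_of r = (p, q)"
    by (rule rat_eq_divide)
  have "0 < r" "r < 1" using 4 by auto
  hence pq: "0 < p" "p < q" using r by (auto simp: zero_less_divide_iff divide_less_eq)
  moreover have "r / (1 - r) = of_int p / of_int (q - p)"
  proof -
    have "(of_int q :: rat) \<noteq> 0" "(of_int q - of_int p :: rat) \<noteq> 0"
      using pq by (simp_all flip: of_int_diff)
    then show ?thesis unfolding r(1) by (simp add: divide_simps)
  qed
  moreover have "coprime p (q - p)"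
    using r(3) by (metis coprime_iff_gcd_eq_1 gcd.commute gcd_diff1)
  ultimately have "quotient_of (r / (1 - r)) = (p, q - p)"
    using quotient_of_divide[of "q - p" p] by simp
  then show ?case using r pq by simp
qed

declare rational_tangle.simps [simp del]

definition montesinos :: "diagram \<Rightarrow> diagram \<Rightarrow> diagram \<Rightarrow> diagram" where
  "montesinos A R B = numerator_closure (horizontal_sum (horizontal_sum A R) B)"

text \<open>The slope of the tangle written \<open>a1 a2 a3\<close> in Conway notation.\<close>

definition conway_slope :: "nat \<Rightarrow> nat \<Rightarrow> nat \<Rightarrow> rat" where
  "conway_slope a1 a2 a3 = 1 / (of_nat a3 + 1 / (of_nat a2 + 1 / of_nat a1))"

lemma conway_slope_eq:
  assumes "a1 > 0" "a2 > 0" "a3 > 0"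
  shows "conway_slope a1 a2 a3 =
    of_nat (1 + a1 * a2) / of_nat (a1 + a3 + a1 * a2 * a3)"
proof -
  have "of_nat a2 + 1 / of_nat a1 = (of_nat (1 + a1 * a2) / of_nat a1 :: rat)"
    using assms by (simp add: field_simps)
  moreover have "of_nat a3 + of_nat a1 / of_nat (1 + a1 * a2) =
    (of_nat (a1 + a3 + a1 * a2 * a3) / of_nat (1 + a1 * a2) :: rat)"
    using assms by (simp add: field_simps del: of_nat_Suc) (simp add: algebra_simps)
  ultimately show ?thesis
    by (simp add: conway_slope_def)
qed

lemma is_tangle_append:
  "is_tangle m w n \<Longrightarrow> is_tangle n w' k \<Longrightarrow> is_tangle m (w @ w') k"
  by (induction m w n rule: is_tangle.induct) auto

lemma is_tangle_widen:
  "is_tangle m w n \<Longrightarrow> is_tangle (m + k) w (n + k)"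
proof (induction m w n rule: is_tangle.induct)
  case (2 m p i w n)
  then have "m + k - ins p + outs p = m - ins p + outs p + k" by auto
  with 2 show ?case unfolding is_tangle.simps by (metis trans_le_add1)
qed simp

lemma is_tangle_shift:
  "is_tangle m w n \<Longrightarrow> is_tangle (k + m) (shift k w) (k + n)"
proof (induction m w n rule: is_tangle.induct)
  case (2 m p i w n)
  then have "k + m - ins p + outs p = k + (m - ins p + outs p)" by auto
  moreover have "shift k ((p, i) # w) = (p, i + k) # shift k w"
    by (simp add: shift_def)
  moreover have "i + k + ins p \<le> k + m" using 2 by simp
  ultimately show ?case using 2 by (metis is_tangle.simps(2))
qed (simp add: shift_def)

lemma is_tangle_horizontal_sum:
  assumes "is_tangle 2 A 2" "is_tangle 2 B 2"
  shows "is_tangle 2 (horizontal_sum A B) 2"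
proof -
  have "is_tangle 4 (A @ shift 2 B @ [(Cap, 1)]) 2"
    using is_tangle_widen[OF assms(1), of 2] is_tangle_shift[OF assms(2), of 2]
    by (auto intro!: is_tangle_append[of _ _ 4])
  then show ?thesis by (simp add: horizontal_sum_def)
qed

lemma is_tangle_mirror: "is_tangle m (mirror w) n \<longleftrightarrow> is_tangle m w n"
  by (induction m w n rule: is_tangle.induct) (auto simp: mirror_def split: piece.splits)

lemma is_tangle_rational: "is_tangle 2 (rational_tangle r) 2"
proof (induction r rule: rational_tangle.induct)
  case (1 r)
  then show ?case
    by (subst rational_tangle.simps)
      (auto simp: is_tangle_mirror vertical_sum_def
        intro!: is_tangle_horizontal_sum is_tangle_append[of _ _ 2])
qed

lemma link_diagram_montesinos:
  assumes "is_tangle 2 A 2" "is_tangle 2 R 2" "is_tangle 2 B 2"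
  shows "link_diagram (montesinos A R B)"
proof -
  have "is_tangle 2 (horizontal_sum (horizontal_sum A R) B @ [(Cap, 0)]) 0"
    using assms by (intro is_tangle_append[of _ _ 2] is_tangle_horizontal_sum) auto
  then show ?thesis
    by (simp add: link_diagram_def montesinos_def numerator_closure_def numeral_2_eq_2)
qed

end

(*
  The standard diagram of L has at most q + max u v + Q crossings when the slopes are p/q, u/v, -P/Q
  with p < q and P < Q, since T(p/q) has at most max p q crossings.  This is at most
  v(pQ - qP) + uqQ, so it suffices to bound det(L) from below by that number.

  At t = -1 the Alexander matrix is the matrix of Fox colorings.  A coloring of a rational tangle
  T(p/q) is determined by the color of one end and one parameter t: the colors change by -pt from
  left to right and by qt from bottom to top.  So the colorings of L, normalized to be 0 on one arc,
  are given by three parameters and a 3x3 matrix E with |det E| = v(pQ - qP) + uqQ.  The universal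
  such coloring takes values in the group Z^3 / (row span of E) and its colors generate this group,
  which forces det E to divide det(L).  Since det E is nonzero, there are no nonconstant integral
  colorings, so det(L) is nonzero and hence at least |det E|.
*)

theory Submission
  imports Defs
begin

section \<open>Fox colorings modulo a subgroup\<close>

text \<open>\<open>coloring H w us gs vs\<close>: the strands at the bottom and at the top of \<open>w\<close> have the colors \<open>us\<close>
  and \<open>vs\<close>, and the \<open>k\<close>-th generator introduced when \<open>w\<close> is read upwards has the color \<open>gs ! k\<close>.
  The relations are only required modulo \<open>H\<close>.\<close>

inductive coloring ::
    "'a :: comm_ring_1 set \<Rightarrow> diagram \<Rightarrow> 'a list \<Rightarrow> 'a list \<Rightarrow> 'a list \<Rightarrow> bool"
  for H where
  nil: "coloring H [] us [] us"
| cup: "coloring H w (xs @ [g, g] @ zs) gs vs \<Longrightarrow>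
    coloring H ((Cup, length xs) # w) (xs @ zs) (g # gs) vs"
| cap: "x - y \<in> H \<Longrightarrow> coloring H w (xs @ zs) gs vs \<Longrightarrow>
    coloring H ((Cap, length xs) # w) (xs @ [x, y] @ zs) gs vs"
| cross_true: "2 * x - y - g \<in> H \<Longrightarrow> coloring H w (xs @ [g, x] @ zs) gs vs \<Longrightarrow>
    coloring H ((Cross True, length xs) # w) (xs @ [x, y] @ zs) (g # gs) vs"
| cross_false: "2 * y - x - g \<in> H \<Longrightarrow> coloring H w (xs @ [y, g] @ zs) gs vs \<Longrightarrow>
    coloring H ((Cross False, length xs) # w) (xs @ [x, y] @ zs) (g # gs) vs"

lemma coloring_append:
  "coloring H w us gs vs \<Longrightarrow> coloring H w' vs gs' vs' \<Longrightarrow>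
    coloring H (w @ w') us (gs @ gs') vs'"
  by (induction rule: coloring.induct) (auto intro: coloring.intros[simplified])

lemma coloring_nil_iff [simp]: "coloring H [] us gs vs \<longleftrightarrow> gs = [] \<and> vs = us"
  by (auto elim: coloring.cases intro: coloring.nil)

lemma coloring_appendE:
  assumes "coloring H (w @ w') us gs vs"
  obtains gs1 gs2 ms where "gs = gs1 @ gs2" "coloring H w us gs1 ms" "coloring H w' ms gs2 vs"
proof -
  have "\<exists>gs1 gs2 ms. gs = gs1 @ gs2 \<and> coloring H w us gs1 ms \<and> coloring H w' ms gs2 vs"
    using assms
  proof (induction w arbitrary: us gs)
    case Nil
    then show ?case by auto
  next
    case (Cons l w)
    from Cons.prems have "coloring H (l # (w @ w')) us gs vs" by simp
    then show ?case
    proof cases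
      case (cup xs g zs gs')
      from Cons.IH[OF cup(4)] show ?thesis
        using cup(1-3) by (metis append_Cons coloring.cup)
    next
      case (cap x y xs zs)
      from Cons.IH[OF cap(4)] show ?thesis
        using cap(1-3) by (metis append_Cons coloring.cap)
    next
      case (cross_true x y g xs zs gs')
      from Cons.IH[OF cross_true(5)] show ?thesis
        using cross_true(1-4) by (metis append_Cons coloring.cross_true)
    next
      case (cross_false y x g xs zs gs')
      from Cons.IH[OF cross_false(5)] show ?thesis
        using cross_false(1-4) by (metis append_Cons coloring.cross_false)
    qed
  qed
  with that show thesis by blast
qed

lemma coloring_widen:
  "coloring H w us gs vs \<Longrightarrow> coloring H w (us @ ys) gs (vs @ ys)"
  by (induction rule: coloring.induct) (auto intro: coloring.intros[simplified])

lemma coloring_shift: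
  "coloring H w us gs vs \<Longrightarrow> coloring H (shift (length ys) w) (ys @ us) gs (ys @ vs)"
proof (induction rule: coloring.induct)
  case (nil us)
  then show ?case by (simp add: shift_def)
next
  case (cup w xs g zs gs vs)
  then show ?case
    using coloring.cup[of H _ "ys @ xs" g zs gs] by (simp add: shift_def add.commute)
next
  case (cap x y w xs zs gs vs)
  then show ?case
    using coloring.cap[of x y H _ "ys @ xs" zs gs] by (simp add: shift_def add.commute)
next
  case (cross_true x y g w xs zs gs vs)
  then show ?case
    using coloring.cross_true[of x y g H _ "ys @ xs" zs gs] by (simp add: shift_def add.commute)
next
  case (cross_false y x g w xs zs gs vs)
  then show ?case
    using coloring.cross_false[of y x g H _ "ys @ xs" zs gs] by (simp add: shift_def add.commute)
qed

text \<open>Inversion at the first piece. The position \<open>i\<close> is tied to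
  \<open>length xs\<close> only by a premise, so that numerals and sums such as
  \<open>length ls + i\<close> can be matched; likewise in the next three lemmas.\<close>

lemma coloring_cup_iff:
  "i = length xs \<Longrightarrow> coloring H ((Cup, i) # w) (xs @ zs) gs vs \<longleftrightarrow>
    (\<exists>g gs'. gs = g # gs' \<and> coloring H w (xs @ [g, g] @ zs) gs' vs)"
  by (auto intro: coloring.cup[simplified] elim: coloring.cases)

lemma coloring_cap_iff:
  "i = length xs \<Longrightarrow> coloring H ((Cap, i) # w) (xs @ [x, y] @ zs) gs vs \<longleftrightarrow>
    x - y \<in> H \<and> coloring H w (xs @ zs) gs vs"
  by (auto intro: coloring.cap[simplified] elim: coloring.cases)

lemma coloring_cross_true_iff:
  "i = length xs \<Longrightarrow> coloring H ((Cross True, i) # w) (xs @ [x, y] @ zs) gs vs \<longleftrightarrow>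
    (\<exists>g gs'. gs = g # gs' \<and> 2 * x - y - g \<in> H \<and> coloring H w (xs @ [g, x] @ zs) gs' vs)"
  by (auto intro: coloring.cross_true[simplified] elim: coloring.cases)

lemma coloring_cross_false_iff:
  "i = length xs \<Longrightarrow> coloring H ((Cross False, i) # w) (xs @ [x, y] @ zs) gs vs \<longleftrightarrow>
    (\<exists>g gs'. gs = g # gs' \<and> 2 * y - x - g \<in> H \<and> coloring H w (xs @ [y, g] @ zs) gs' vs)"
  by (auto intro: coloring.cross_false[simplified] elim: coloring.cases)

lemma split_two:
  assumes "i + 2 \<le> length us"
  obtains xs x y zs where "us = xs @ [x, y] @ zs" "i = length xs"
proof
  show "us = take i us @ [us ! i, us ! Suc i] @ drop (Suc (Suc i)) us"
    using assms by (simp add: Cons_nth_drop_Suc)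
  show "i = length (take i us)" using assms by simp
qed

lemma split_at:
  assumes "i \<le> length us"
  obtains xs zs where "us = xs @ zs" "i = length xs"
  using assms by (metis append_take_drop_id length_take min.absorb2)

text \<open>A tangle does not touch the strands to its left and to its right.\<close>

lemma coloring_shift_widenD:
  assumes "coloring H (shift (length ls) w) (ls @ us @ rs) gs vs" "is_tangle (length us) w n"
  obtains ms where "vs = ls @ ms @ rs" "coloring H w us gs ms" "length ms = n"
proof -
  have "\<exists>ms. vs = ls @ ms @ rs \<and> coloring H w us gs ms \<and> length ms = n"
    using assms
  proof (induction w arbitrary: us gs)
    case Nil
    then show ?case by (auto simp: shift_def)
  next
    case (Cons l w)
    obtain p i where l: "l = (p, i)" by force
    have sh: "shift (length ls) (l # w) = (p, length ls + i) # shift (length ls) w"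
      by (simp add: shift_def l add.commute)
    have tan: "i + ins p \<le> length us" "is_tangle (length us - ins p + outs p) w n"
      using Cons.prems(2) by (auto simp: l)
    show ?case
    proof (cases p)
      case Cup
      then obtain xs zs where us: "us = xs @ zs" "i = length xs"
        using tan(1) by (auto elim: split_at)
      obtain g gs' where g: "gs = g # gs'"
        "coloring H (shift (length ls) w) (ls @ (xs @ [g, g] @ zs) @ rs) gs' vs"
        using coloring_cup_iff[of "length ls + i" "ls @ xs" H "shift (length ls) w" "zs @ rs" gs vs] Cons.prems(1)
        unfolding sh us Cup by auto
      have "is_tangle (length (xs @ [g, g] @ zs)) w n"
        using tan(2) by (simp add: us Cup)
      from Cons.IH[OF g(2) this] show ?thesis
        using g(1) l us Cup coloring.cup by metis
    next
      case Cap
      then have "i + 2 \<le> length us" using tan(1) by simp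
      then obtain xs x y zs where us: "us = xs @ [x, y] @ zs" "i = length xs"
        by (rule split_two)
      have g: "x - y \<in> H" "coloring H (shift (length ls) w) (ls @ (xs @ zs) @ rs) gs vs"
        using coloring_cap_iff[of "length ls + i" "ls @ xs" H "shift (length ls) w" x y "zs @ rs" gs vs] Cons.prems(1)
        unfolding sh us Cap by auto
      have "is_tangle (length (xs @ zs)) w n"
        using tan(2) by (simp add: us Cap)
      from Cons.IH[OF g(2) this] show ?thesis
        using g(1) l us Cap coloring.cap by metis
    next
      case (Cross s)
      then have "i + 2 \<le> length us" using tan(1) by simp
      then obtain xs x y zs where us: "us = xs @ [x, y] @ zs" "i = length xs"
        by (rule split_two)
      show ?thesis
      proof (cases s)
        case True
        obtain g gs' where g: "gs = g # gs'" "2 * x - y - g \<in> H"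
          "coloring H (shift (length ls) w) (ls @ (xs @ [g, x] @ zs) @ rs) gs' vs"
          using coloring_cross_true_iff[of "length ls + i" "ls @ xs" H "shift (length ls) w" x y "zs @ rs" gs vs] Cons.prems(1)
          unfolding sh us Cross using True by auto
        have "is_tangle (length (xs @ [g, x] @ zs)) w n"
          using tan(2) by (simp add: us Cross)
        from Cons.IH[OF g(3) this] show ?thesis
          using g(1,2) l us Cross True coloring.cross_true by metis
      next
        case False
        obtain g gs' where g: "gs = g # gs'" "2 * y - x - g \<in> H"
          "coloring H (shift (length ls) w) (ls @ (xs @ [y, g] @ zs) @ rs) gs' vs"
          using coloring_cross_false_iff[of "length ls + i" "ls @ xs" H "shift (length ls) w" x y "zs @ rs" gs vs] Cons.prems(1)
          unfolding sh us Cross using False by auto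
        have "is_tangle (length (xs @ [y, g] @ zs)) w n"
          using tan(2) by (simp add: us Cross)
        from Cons.IH[OF g(3) this] show ?thesis
          using g(1,2) l us Cross False coloring.cross_false by (metis (full_types))
      qed
    qed
  qed
  with that show thesis by blast
qed

lemma shift_0 [simp]: "shift 0 w = w"
  by (simp add: shift_def)

section \<open>The coloring matrix\<close>

definition generators :: "diagram \<Rightarrow> nat" where
  "generators w = length (filter (\<lambda>l. fst l \<noteq> Cap) w)"

lemma generators_simps [simp]:
  "generators [] = 0"
  "generators ((p, i) # w) = (if p = Cap then generators w else Suc (generators w))"
  by (auto simp: generators_def)

lemma length_coloring: "coloring H w us gs vs \<Longrightarrow> length gs = generators w"
  by (induction rule: coloring.induct) auto

text \<open>Puts the upper colors of a tangle into any subgroup that contains its lower colors and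
  its generators.\<close>

lemma coloring_in_gens:
  "coloring H w us gs vs \<Longrightarrow> set vs \<subseteq> set us \<union> set gs"
  by (induction rule: coloring.induct) auto

definition rel_value :: "nat \<Rightarrow> (nat \<Rightarrow> 'a :: comm_ring_1) \<Rightarrow> (nat \<Rightarrow> int poly) \<Rightarrow> 'a" where
  "rel_value N g r = (\<Sum>k<N. of_int (poly (r k) (- 1)) * g k)"

lemma rel_value_linear_form:
  assumes "\<forall>(c, k) \<in> set cs. k < N"
  shows "rel_value N g (linear_form cs) = (\<Sum>(c, k)\<leftarrow>cs. of_int (poly c (- 1)) * g k)"
  using assms
proof (induction cs)
  case Nil
  then show ?case by (simp add: rel_value_def linear_form_def)
next
  case (Cons a cs)
  obtain c k where a: "a = (c, k)" by force
  have "rel_value N g (linear_form (a # cs)) =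
      (\<Sum>j<N. (if j = k then of_int (poly c (- 1)) * g k else 0)) + rel_value N g (linear_form cs)"
    unfolding rel_value_def sum.distrib[symmetric]
    by (intro sum.cong) (auto simp: a linear_form_def algebra_simps)
  then show ?case using Cons a by simp
qed

text \<open>At t = -1 the coefficients 1 - t, t and -1 become 2, -1 and -1. This is the Fox coloring
  condition; it is symmetric in left and right, so the orientation drops out.\<close>

lemma rel_value_crossing:
  assumes "over < N" "left < N" "right < N"
  shows "rel_value N g (crossing_relation over left right) = 2 * g over - g left - g right"
  using assms unfolding crossing_relation_def
  by (subst rel_value_linear_form) auto

text \<open>Each cap or crossing contributes to the left-hand side exactly the condition that its
  rule in \<open>coloring\<close> demands. The strands and the counter \<open>n\<close> vary in the
  induction, while the bound \<open>N\<close> on all generators stays fixed.\<close>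

lemma relations_coloring:
  assumes "is_tangle (length st) w m" "\<forall>x\<in>set st. fst x < n" "n + generators w \<le> N"
  shows "(\<forall>r\<in>set (relations_from orient (st, n) w). rel_value N g r \<in> H) \<longleftrightarrow>
    (\<exists>vs. coloring H w (map (g \<circ> fst) st) (map g [n..<n + generators w]) vs)"
  using assms
proof (induction w arbitrary: st n)
  case Nil
  then show ?case by simp
next
  case (Cons l w)
  obtain p i where l: "l = (p, i)" by force
  have tan: "i + ins p \<le> length st" "is_tangle (length st - ins p + outs p) w m"
    using Cons.prems(1) by (auto simp: l)
  show ?case
  proof (cases p)
    case Cup
    then obtain xs zs where st: "st = xs @ zs" "i = length xs"
      using tan(1) by (auto elim: split_at)
    define st' where "st' = xs @ [(n, orient n), (n, \<not> orient n)] @ zs"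
    have "(\<forall>r\<in>set (relations_from orient (st', Suc n) w). rel_value N g r \<in> H) \<longleftrightarrow>
      (\<exists>vs. coloring H w (map (g \<circ> fst) st') (map g [Suc n..<Suc n + generators w]) vs)"
      using Cons.prems tan(2) by (intro Cons.IH) (auto simp: st'_def st l Cup less_Suc_eq)
    then show ?thesis
      by (simp add: coloring_cup_iff o_def l Cup st st'_def upt_rec[of n] del: upt_Suc)
  next
    case Cap
    then have "i + 2 \<le> length st" using tan(1) by simp
    then obtain xs x y zs where st: "st = xs @ [x, y] @ zs" "i = length xs"
      by (rule split_two)
    have "(\<forall>r\<in>set (relations_from orient (xs @ zs, n) w). rel_value N g r \<in> H) \<longleftrightarrow>
      (\<exists>vs. coloring H w (map (g \<circ> fst) (xs @ zs)) (map g [n..<n + generators w]) vs)"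
      using Cons.prems tan(2) by (intro Cons.IH) (auto simp: st l Cap)
    moreover have "fst x < N" "fst y < N"
      using Cons.prems by (auto simp: st)
    ultimately show ?thesis
      by (simp add: coloring_cap_iff[simplified] o_def l Cap st nth_append rel_value_linear_form)
  next
    case (Cross s)
    then have "i + 2 \<le> length st" using tan(1) by simp
    then obtain xs x y zs where st: "st = xs @ [x, y] @ zs" "i = length xs"
      by (rule split_two)
    have bounds: "fst x < N" "fst y < N" "n < N"
      using Cons.prems by (auto simp: st l Cross)
    show ?thesis
    proof (cases s)
      case True
      define st' where "st' = xs @ [(n, snd y), x] @ zs"
      have "(\<forall>r\<in>set (relations_from orient (st', Suc n) w). rel_value N g r \<in> H) \<longleftrightarrow>
        (\<exists>vs. coloring H w (map (g \<circ> fst) st') (map g [Suc n..<Suc n + generators w]) vs)"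
        using Cons.prems tan(2) by (intro Cons.IH) (auto simp: st'_def st l Cross less_Suc_eq)
      then show ?thesis using bounds
        by (simp add: coloring_cross_true_iff[simplified] o_def l Cross True st st'_def upt_rec[of n] nth_append rel_value_crossing
            split_beta algebra_simps del: upt_Suc)
    next
      case False
      define st' where "st' = xs @ [y, (n, snd x)] @ zs"
      have "(\<forall>r\<in>set (relations_from orient (st', Suc n) w). rel_value N g r \<in> H) \<longleftrightarrow>
        (\<exists>vs. coloring H w (map (g \<circ> fst) st') (map g [Suc n..<Suc n + generators w]) vs)"
        using Cons.prems tan(2) by (intro Cons.IH) (auto simp: st'_def st l Cross less_Suc_eq)
      then show ?thesis using bounds False
        by (simp add: coloring_cross_false_iff[simplified] o_def l Cross st st'_def upt_rec[of n] nth_append rel_value_crossing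
            split_beta algebra_simps del: upt_Suc)
    qed
  qed
qed

text \<open>A cup adds two strands and a generator, a cap removes two strands and adds a relation,
  and a crossing adds a generator and a relation. From 0 to 2 strands there is thus one generator
  more than relations, and deleting one column leaves a square matrix.\<close>

lemma double_count:
  "is_tangle m w k \<Longrightarrow> m + 2 * generators w = k + 2 * length (relations_from orient (st, n) w)"
proof (induction w arbitrary: m st n)
  case Nil
  then show ?case by simp
next
  case (Cons l w)
  obtain p i where l: "l = (p, i)" by force
  obtain st' n' where adv: "advance orient (st, n) l = (st', n')" by force
  have "length (piece_relations (st, n) l) = (if p = Cup then 0 else 1)"
    by (cases p) (auto simp: l split: prod.splits)
  moreover have "m - ins p + outs p + 2 * generators w =
      k + 2 * length (relations_from orient (st', n') w)"
    using Cons by (auto simp: l)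
  ultimately show ?case
    using Cons.prems adv by (cases p) (auto simp: l)
qed

section \<open>Subgroups, row lattices and divisibility of determinants\<close>

definition add_subgroup :: "'a :: ab_group_add set \<Rightarrow> bool" where
  "add_subgroup H \<longleftrightarrow> 0 \<in> H \<and> (\<forall>x\<in>H. \<forall>y\<in>H. x - y \<in> H)"

lemma add_subgroup_zero: "add_subgroup H \<Longrightarrow> 0 \<in> H"
  and add_subgroup_diff: "add_subgroup H \<Longrightarrow> x \<in> H \<Longrightarrow> y \<in> H \<Longrightarrow> x - y \<in> H"
  by (auto simp: add_subgroup_def)

lemma add_subgroup_uminus: "add_subgroup H \<Longrightarrow> x \<in> H \<Longrightarrow> - x \<in> H"
  using add_subgroup_diff[of H 0 x] add_subgroup_zero[of H] by simp

lemma add_subgroup_add: "add_subgroup H \<Longrightarrow> x \<in> H \<Longrightarrow> y \<in> H \<Longrightarrow> x + y \<in> H"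
  using add_subgroup_diff[of H x "- y"] add_subgroup_uminus[of H y] by simp

lemma add_subgroup_of_int_mult:
  assumes "add_subgroup H" "x \<in> H"
  shows "of_int c * x \<in> H"
proof -
  have nat: "of_nat n * x \<in> H" for n
    using assms by (induction n) (auto simp: algebra_simps add_subgroup_zero add_subgroup_add)
  show ?thesis
    using nat[of "nat c"] nat[of "nat (- c)"] add_subgroup_uminus[OF assms(1)]
    by (cases "c \<ge> 0") fastforce+
qed

text \<open>An element of \<open>\<int>\<^sup>k\<close> is represented by any polynomial with these \<open>k\<close> lowest coefficients.\<close>

definition row_span :: "nat \<Rightarrow> int mat \<Rightarrow> int poly set" where
  "row_span k E = {h. \<exists>c. \<forall>j<k. coeff h j = (\<Sum>i<k. c i * E $$ (i, j))}"

lemma add_subgroup_row_span: "add_subgroup (row_span k E)"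
  unfolding add_subgroup_def
proof (intro conjI ballI)
  show "0 \<in> row_span k E"
    unfolding row_span_def by (auto intro: exI[of _ "\<lambda>_. 0"])
  fix x y assume "x \<in> row_span k E" "y \<in> row_span k E"
  then obtain c d where "\<forall>j<k. coeff x j = (\<Sum>i<k. c i * E $$ (i, j))"
    "\<forall>j<k. coeff y j = (\<Sum>i<k. d i * E $$ (i, j))"
    unfolding row_span_def by blast
  then have "\<forall>j<k. coeff (x - y) j = (\<Sum>i<k. (c i - d i) * E $$ (i, j))"
    by (simp add: sum_subtractf algebra_simps)
  then show "x - y \<in> row_span k E"
    unfolding row_span_def by (intro CollectI exI[of _ "\<lambda>i. c i - d i"])
qed

text \<open>Multiply the block matrix with rows \<open>M Y\<close> and \<open>W Z\<close> by the one with rows \<open>1 X\<close> and \<open>0 E\<close>.\<close>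

lemma det_dvd_det_of_block_inverse:
  fixes M :: "'a :: idom mat"
  assumes carrier: "M \<in> carrier_mat n n" "Y \<in> carrier_mat n k" "W \<in> carrier_mat k n"
      "Z \<in> carrier_mat k k" "X \<in> carrier_mat n k" "E \<in> carrier_mat k k"
    and "M * X + Y * E = 0\<^sub>m n k" "W * X + Z * E = 1\<^sub>m k"
  shows "det E dvd det M"
proof -
  let ?B = "four_block_mat M Y W Z" and ?C = "four_block_mat (1\<^sub>m n) X (0\<^sub>m k n) E"
  have "?B * ?C = four_block_mat M (0\<^sub>m n k) W (1\<^sub>m k)"
    using carrier assms(7,8)
    by (subst mult_four_block_mat[OF carrier(1-4) one_carrier_mat carrier(5) zero_carrier_mat carrier(6)])
      auto
  moreover have "det ?C = det E"
    using carrier by (subst det_four_block_mat_lower_left_zero) auto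
  moreover have "det (four_block_mat M (0\<^sub>m n k) W (1\<^sub>m k)) = det M"
    using carrier by (subst det_four_block_mat_upper_right_zero) auto
  moreover have "det (?B * ?C) = det ?B * det ?C"
    using carrier by (intro det_mult[of _ "n + k"]) auto
  ultimately show ?thesis by (metis dvd_triv_right)
qed

text \<open>The minor of the Alexander matrix at t = -1 for \<open>w\<close> closed by a final cap:
  the cap is the deleted last row, and \<open>Suc j\<close> skips the column of generator 0. By
  \<open>link_det_eq\<close> any function may take the place of the orientation, here the constant
  one.\<close>

definition coloring_minor :: "diagram \<Rightarrow> int mat" where
  "coloring_minor w =
    (let rels = relations_from (\<lambda>_. True) ([], 0) w; n = length rels
     in mat n n (\<lambda>(i, j). poly ((rels ! i) (Suc j)) (- 1)))"

lemma relations_from_append: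
  "relations_from orient S (w @ w') =
    relations_from orient S w @ relations_from orient (foldl (advance orient) S w) w'"
  by (induction w arbitrary: S) auto

lemma link_det_eq_coloring_minor:
  assumes "is_tangle 0 w 2"
  shows "link_det (w @ [(Cap, 0)]) = \<bar>det (coloring_minor w)\<bar>"
proof -
  interpret ev: comm_ring_hom "\<lambda>q :: int poly. poly q (- 1)"
    by unfold_locales auto
  let ?D = "w @ [(Cap, 0)]" and ?o = "\<lambda>_ :: nat. True"
  let ?rels = "relations_from ?o ([], 0) w"
  obtain st n where fin: "foldl (advance ?o) ([], 0) w = (st, n)" by force
  have "link_diagram ?D"
    unfolding link_diagram_def using assms by (intro is_tangle_append[of _ _ 2]) auto
  moreover have "map_mat (\<lambda>q. poly q (- 1))
      (mat_delete (alexander_matrix ?D ?o) (dim_row (alexander_matrix ?D ?o) - 1) 0) =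
      coloring_minor w"
    by (intro eq_matI)
      (auto simp: mat_delete_def alexander_matrix_def Let_def coloring_minor_def nth_append
        relations_from_append fin)
  ultimately show ?thesis
    by (simp add: link_det_eq[of _ ?o] alexander_poly_def flip: ev.hom_det)
qed

lemma coloring_minor_carrier:
  assumes "is_tangle 0 w 2" "generators w = Suc n"
  shows "coloring_minor w \<in> carrier_mat n n"
  using double_count[OF assms(1), of "\<lambda>_. True" "[]" 0] assms(2)
  by (auto simp: coloring_minor_def Let_def)

text \<open>As generator 0 has color 0, the deleted column contributes nothing. The upper colors
  \<open>vs\<close> are unconstrained because the relation of the final cap is the deleted
  row.\<close>

lemma coloring_iff_coloring_minor:
  assumes "is_tangle 0 w 2" "generators w = Suc n" "g 0 = 0"
  shows "(\<exists>vs. coloring H w [] (map g [0..<Suc n]) vs) \<longleftrightarrow>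
    (\<forall>i<n. (\<Sum>j<n. of_int (coloring_minor w $$ (i, j)) * g (Suc j)) \<in> H)"
proof -
  let ?rels = "relations_from (\<lambda>_. True) ([], 0) w"
  have n: "length ?rels = n"
    using double_count[OF assms(1), of "\<lambda>_. True" "[]" 0] assms(2) by simp
  have "rel_value (Suc n) g (?rels ! i) =
      (\<Sum>j<n. of_int (coloring_minor w $$ (i, j)) * g (Suc j))" if "i < n" for i
    using that assms(3) n
    by (simp add: rel_value_def sum.lessThan_Suc_shift coloring_minor_def Let_def del: sum.lessThan_Suc)
  moreover have "(\<forall>r\<in>set ?rels. rel_value (Suc n) g r \<in> H) \<longleftrightarrow>
      (\<exists>vs. coloring H w [] (map g [0..<Suc n]) vs)"
    using relations_coloring[of "[]" w 2 0 "Suc n" "\<lambda>_. True" g H] assms by simp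
  ultimately show ?thesis
    using n by (simp add: all_set_conv_all_nth)
qed

lemma coloring_tangle_length:
  assumes "coloring H w us gs vs" "is_tangle (length us) w n"
  shows "length vs = n"
proof -
  have "coloring H (shift (length ([] :: 'a list)) w) ([] @ us @ []) gs vs"
    using assms(1) by simp
  from coloring_shift_widenD[OF this assms(2)] show ?thesis by auto
qed

section \<open>Nonvanishing and divisors of the link determinant\<close>

fun alternating_sum :: "'a :: comm_ring_1 list \<Rightarrow> 'a" where
  "alternating_sum [] = 0"
| "alternating_sum (x # xs) = x - alternating_sum xs"

lemma alternating_sum_append:
  "alternating_sum (xs @ ys) = alternating_sum xs + (- 1) ^ length xs * alternating_sum ys"
  by (induction xs) (auto simp: algebra_simps)

text \<open>A crossing preserves the difference of its two strands, and a cup or cap inserts or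
  removes two equal neighbors, which cancel.\<close>

lemma coloring_alternating_sum:
  "coloring {0} w us gs vs \<Longrightarrow> alternating_sum vs = alternating_sum us"
proof (induction rule: coloring.induct)
  case (cross_true x y g w xs zs gs vs)
  then have "g = 2 * x - y" by (simp add: algebra_simps)
  with cross_true show ?case by (simp add: alternating_sum_append algebra_simps)
next
  case (cross_false y x g w xs zs gs vs)
  then have "g = 2 * y - x" by (simp add: algebra_simps)
  with cross_false show ?case by (simp add: alternating_sum_append algebra_simps)
qed (auto simp: alternating_sum_append)

text \<open>The deleted relation of the final \<open>Cap\<close> follows from the others, because the alternating sum
  of the colors is the same at every level.\<close>

lemma link_det_nonzero:
  assumes w: "is_tangle 0 w 2"
    and rigid: "\<And>gs v. coloring {0 :: int} w [] (0 # gs) [v, v] \<Longrightarrow> set gs \<subseteq> {0}"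
  shows "link_det (w @ [(Cap, 0)]) \<noteq> 0"
proof
  obtain n where n: "generators w = Suc n"
    using double_count[OF w, of "\<lambda>_. True" "[]" 0] by (cases "generators w") auto
  note M = coloring_minor_carrier[OF w n]
  assume "link_det (w @ [(Cap, 0)]) = 0"
  then have "det (coloring_minor w) = 0"
    using link_det_eq_coloring_minor[OF w] by simp
  then obtain v where v: "v \<in> carrier_vec n" "v \<noteq> 0\<^sub>v n" "coloring_minor w *\<^sub>v v = 0\<^sub>v n"
    using det_0_iff_vec_prod_zero[OF M] by blast
  \<comment> \<open>A kernel vector of the minor becomes a coloring when the color 0 of the first
    generator is put in front.\<close>
  define g where "g = (\<lambda>j. case j of 0 \<Rightarrow> 0 | Suc j \<Rightarrow> v $ j)"
  have "(\<Sum>j<n. of_int (coloring_minor w $$ (i, j)) * g (Suc j)) = 0" if "i < n" for i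
  proof -
    have "(coloring_minor w *\<^sub>v v) $ i = 0" using v(3) that by simp
    then show ?thesis using M v(1) that
      by (simp add: scalar_prod_def g_def lessThan_atLeast0 carrier_matD)
  qed
  then obtain vs where vs: "coloring {0} w [] (map g [0..<Suc n]) vs"
    using coloring_iff_coloring_minor[OF w n, of g "{0}"] by (auto simp: g_def)
  then have "length vs = 2"
    using coloring_tangle_length w by fastforce
  then obtain x y where xy: "vs = [x, y]"
    by (metis (no_types) length_0_conv length_Suc_conv numeral_2_eq_2)
  have "x = y" using coloring_alternating_sum[OF vs] by (simp add: xy)
  moreover have g: "map g [0..<Suc n] = 0 # map (\<lambda>j. v $ j) [0..<n]"
    by (subst map_upt_Suc) (simp add: g_def)
  ultimately have "set (map (\<lambda>j. v $ j) [0..<n]) \<subseteq> {0}"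
    using rigid vs xy by metis
  then have "v = 0\<^sub>v n" using v(1) by (intro eq_vecI) (auto simp: image_subset_iff)
  with v(2) show False by contradiction
qed

text \<open>The colors form a matrix X. The relations hold modulo the rows of E, so M X is a
  combination of these rows, where M is the minor. The colors and the rows of E together generate
  \<int>^k, so the identity matrix is of the form W X + Z E. These are the hypotheses of
  \<open>det_dvd_det_of_block_inverse\<close>.\<close>

lemma det_dvd_link_det:
  fixes E :: "int mat"
  assumes w: "is_tangle 0 w 2" and E: "E \<in> carrier_mat k k"
    and col: "coloring (row_span k E) w [] (0 # gs) vs"
    and gen: "\<And>S j. add_subgroup S \<Longrightarrow> row_span k E \<subseteq> S \<Longrightarrow> set gs \<subseteq> S \<Longrightarrow> j < k \<Longrightarrow> monom 1 j \<in> S"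
  shows "det E dvd link_det (w @ [(Cap, 0)])"
proof -
  define n where "n = length gs"
  have n: "generators w = Suc n"
    using length_coloring[OF col] by (simp add: n_def)
  define g where "g = (\<lambda>j. (0 # gs) ! j)"
  have g: "map g [0..<Suc n] = 0 # gs"
    using map_nth[of "0 # gs"] by (simp add: g_def n_def del: upt_Suc)
  have "\<exists>c. \<forall>l<k. coeff (\<Sum>j<n. of_int (coloring_minor w $$ (i, j)) * g (Suc j)) l =
      (\<Sum>i<k. c i * E $$ (i, l))" if "i < n" for i
    using coloring_iff_coloring_minor[OF w n, of g "row_span k E"] col that g
    unfolding row_span_def by (auto simp: g_def)
  then obtain y where y: "\<And>i l. i < n \<Longrightarrow> l < k \<Longrightarrow>
      coeff (\<Sum>j<n. of_int (coloring_minor w $$ (i, j)) * g (Suc j)) l =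
      (\<Sum>m<k. y i m * E $$ (m, l))"
    by metis
  \<comment> \<open>The subgroup generated by the colors and the rows of \<open>E\<close>, up to
    coefficients of degree at least \<open>k\<close>. Applying \<open>gen\<close> to it writes the
    unit vectors as combinations of these generators.\<close>
  define S where "S = {h :: int poly. \<exists>c d. \<forall>l<k. coeff h l =
    (\<Sum>i<n. c i * coeff (gs ! i) l) + (\<Sum>i<k. d i * E $$ (i, l))}"
  have "add_subgroup S"
    unfolding add_subgroup_def
  proof (intro conjI ballI)
    show "0 \<in> S"
      unfolding S_def by (intro CollectI exI[of _ "\<lambda>_. 0"]) simp
    fix p q assume "p \<in> S" "q \<in> S"
    then obtain c d c' d' where
      "\<forall>l<k. coeff p l = (\<Sum>i<n. c i * coeff (gs ! i) l) + (\<Sum>i<k. d i * E $$ (i, l))"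
      "\<forall>l<k. coeff q l = (\<Sum>i<n. c' i * coeff (gs ! i) l) + (\<Sum>i<k. d' i * E $$ (i, l))"
      unfolding S_def by blast
    then have "\<forall>l<k. coeff (p - q) l = (\<Sum>i<n. (c i - c' i) * coeff (gs ! i) l) +
        (\<Sum>i<k. (d i - d' i) * E $$ (i, l))"
      by (simp add: sum_subtractf left_diff_distrib)
    then show "p - q \<in> S"
      unfolding S_def
      by (intro CollectI exI[of _ "\<lambda>i. c i - c' i"] exI[of _ "\<lambda>i. d i - d' i"])
  qed
  moreover have "row_span k E \<subseteq> S"
  proof
    fix h assume "h \<in> row_span k E"
    then obtain d where "\<forall>j<k. coeff h j = (\<Sum>i<k. d i * E $$ (i, j))"
      unfolding row_span_def by blast
    then show "h \<in> S"
      unfolding S_def by (intro CollectI exI[of _ "\<lambda>_. 0"] exI[of _ d]) simp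
  qed
  moreover have "set gs \<subseteq> S"
  proof
    fix h assume "h \<in> set gs"
    then obtain i where i: "i < n" "h = gs ! i"
      by (metis in_set_conv_nth n_def)
    then have "(\<Sum>m<n. (if m = i then 1 else 0) * coeff (gs ! m) l) = coeff h l" for l
      by (simp add: if_distrib[where f = "\<lambda>x. x * _"] cong: if_cong)
    then show "h \<in> S"
      unfolding S_def
      by (intro CollectI exI[of _ "\<lambda>m. if m = i then 1 else 0"] exI[of _ "\<lambda>_. 0"]) simp
  qed
  ultimately have "monom 1 j \<in> S" if "j < k" for j
    using gen that by blast
  then have "\<exists>c d. \<forall>l<k. coeff (monom (1 :: int) j) l =
    (\<Sum>i<n. c i * coeff (gs ! i) l) + (\<Sum>i<k. d i * E $$ (i, l))" if "j < k" for j
    using that unfolding S_def by blast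
  then obtain c d where cd: "\<And>j l. j < k \<Longrightarrow> l < k \<Longrightarrow> coeff (monom (1 :: int) j) l =
    (\<Sum>i<n. c j i * coeff (gs ! i) l) + (\<Sum>i<k. d j i * E $$ (i, l))"
    by metis
  let ?X = "mat n k (\<lambda>(i, l). coeff (gs ! i) l)"
  note M = coloring_minor_carrier[OF w n]
  \<comment> \<open>\<open>Y\<close> carries a minus sign because \<open>y\<close> expresses M X
    itself through the rows of \<open>E\<close>.\<close>
  have "det E dvd det (coloring_minor w)"
  proof (rule det_dvd_det_of_block_inverse[where X = ?X
        and Y = "mat n k (\<lambda>(i, m). - y i m)" and W = "mat k n (\<lambda>(j, i). c j i)"
        and Z = "mat k k (\<lambda>(j, i). d j i)"])
    show "coloring_minor w * ?X + mat n k (\<lambda>(i, m). - y i m) * E = 0\<^sub>m n k"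
    proof (intro eq_matI)
      fix i l assume "i < dim_row (0\<^sub>m n k)" "l < dim_col (0\<^sub>m n k)"
      then have il: "i < n" "l < k" by auto
      have "(\<Sum>j<n. coloring_minor w $$ (i, j) * coeff (gs ! j) l) = (\<Sum>m<k. y i m * E $$ (m, l))"
        using y[OF il] by (simp add: coeff_sum g_def of_int_poly)
      then show "(coloring_minor w * ?X + mat n k (\<lambda>(i, m). - y i m) * E) $$ (i, l) = 0\<^sub>m n k $$ (i, l)"
        using il M E by (simp add: scalar_prod_def lessThan_atLeast0 carrier_matD sum_negf)
    qed (use M E in auto)
    show "mat k n (\<lambda>(j, i). c j i) * ?X + mat k k (\<lambda>(j, i). d j i) * E = 1\<^sub>m k"
    proof (intro eq_matI)
      fix j l assume "j < dim_row (1\<^sub>m k :: int mat)" "l < dim_col (1\<^sub>m k :: int mat)"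
      then have jl: "j < k" "l < k" by auto
      show "(mat k n (\<lambda>(j, i). c j i) * ?X + mat k k (\<lambda>(j, i). d j i) * E) $$ (j, l) = 1\<^sub>m k $$ (j, l)"
        using jl E cd[OF jl]
        by (simp add: scalar_prod_def lessThan_atLeast0 carrier_matD split: if_splits)
    qed (use E in auto)
  qed (use M E in auto)
  then show ?thesis
    by (simp add: link_det_eq_coloring_minor[OF w])
qed

section \<open>Rational tangles\<close>

lemma crossings_simps [simp]:
  "crossings [] = 0"
  "crossings ((p, i) # w) = (if p = Cup \<or> p = Cap then crossings w else Suc (crossings w))"
  by (cases p; simp add: crossings_def)+

lemma crossings_append [simp]: "crossings (w @ w') = crossings w + crossings w'"
  by (simp add: crossings_def)

lemma crossings_shift [simp]: "crossings (shift k w) = crossings w"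
  by (induction w) (auto simp: shift_def)

lemma crossings_horizontal_sum [simp]:
  "crossings (horizontal_sum A B) = crossings A + crossings B"
  by (simp add: horizontal_sum_def)

text \<open>\<open>rat_tangle s p q w\<close>: the tangle \<open>w\<close> is built like \<open>T(p / q)\<close>, but from the
  crossing \<open>Cross s\<close>.\<close>

inductive rat_tangle :: "bool \<Rightarrow> nat \<Rightarrow> nat \<Rightarrow> diagram \<Rightarrow> bool" for s where
  one: "rat_tangle s 1 1 [(Cross s, 0)]"
| hor: "rat_tangle s p q w \<Longrightarrow> rat_tangle s (p + q) q (horizontal_sum w [(Cross s, 0)])"
| ver: "rat_tangle s p q w \<Longrightarrow> rat_tangle s p (p + q) (vertical_sum w [(Cross s, 0)])"

lemma mirror_append: "mirror (w @ w') = mirror w @ mirror w'"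
  and mirror_horizontal_sum:
    "mirror (horizontal_sum w w') = horizontal_sum (mirror w) (mirror w')"
  by (simp_all add: mirror_def shift_def horizontal_sum_def split_beta comp_def
      split: piece.splits)

lemma mirror_cross: "mirror [(Cross s, i)] = [(Cross (\<not> s), i)]"
  by (simp add: mirror_def)

lemma rat_tangle_mirror: "rat_tangle s p q w \<Longrightarrow> rat_tangle (\<not> s) p q (mirror w)"
  by (induction rule: rat_tangle.induct)
    (simp_all add: mirror_horizontal_sum mirror_append mirror_cross vertical_sum_def
      rat_tangle.one[simplified]
      rat_tangle.hor rat_tangle.ver[unfolded vertical_sum_def])

lemma rational_tangle_gt_one:
  "r > 1 \<Longrightarrow> rational_tangle r = horizontal_sum (rational_tangle (r - 1)) [(Cross True, 0)]"
  by (subst rational_tangle.simps) simp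

lemma rational_tangle_lt_one:
  "0 < r \<Longrightarrow> r < 1 \<Longrightarrow>
    rational_tangle r = vertical_sum (rational_tangle (r / (1 - r))) [(Cross True, 0)]"
  by (subst rational_tangle.simps) simp

text \<open>The recursion of \<open>rational_tangle\<close> is the subtractive Euclidean algorithm
  on (p, q): it passes to (p - q, q) or (p, q - p), preserves coprimality and stops at (1,
  1).\<close>

lemma rat_tangle_rational_tangle:
  assumes "p > 0" "q > 0" "coprime p q"
  shows "rat_tangle True p q (rational_tangle (of_nat p / of_nat q))"
  using assms
proof (induction "p + q" arbitrary: p q rule: less_induct)
  case less
  let ?r = "of_nat p / of_nat q :: rat"
  have r0: "?r > 0" using less.prems by simp
  consider "p = q" | "q < p" | "p < q" by linarith
  then show ?case
  proof cases
    case 1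
    then have "p = 1" "q = 1" using less.prems by simp_all
    then show ?thesis using rat_tangle.one by (simp add: rational_tangle.simps[of 1])
  next
    case 2
    then have "?r > 1" using less.prems by (simp add: less_divide_eq)
    moreover have "?r - 1 = of_nat (p - q) / of_nat q"
      using 2 less.prems by (simp add: field_simps of_nat_diff)
    ultimately have eq: "rational_tangle ?r =
        horizontal_sum (rational_tangle (of_nat (p - q) / of_nat q)) [(Cross True, 0)]"
      using rational_tangle_gt_one[of ?r] by simp
    have "coprime (p - q) q"
      using less.prems(3) 2 by (simp add: coprime_iff_gcd_eq_1 gcd_diff1_nat)
    then have "rat_tangle True (p - q) q (rational_tangle (of_nat (p - q) / of_nat q))"
      using less.prems 2 by (intro less.hyps) auto
    from rat_tangle.hor[OF this] show ?thesis
      using 2 by (simp add: eq)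
  next
    case 3
    then have "?r < 1" using less.prems by (simp add: divide_less_eq)
    moreover have "?r / (1 - ?r) = of_nat p / of_nat (q - p)"
    proof -
      have "(of_nat q :: rat) \<noteq> 0" "(of_nat q - of_nat p :: rat) \<noteq> 0"
        using 3 by simp_all
      then show ?thesis using 3 by (simp add: divide_simps of_nat_diff)
    qed
    ultimately have eq: "rational_tangle ?r =
        vertical_sum (rational_tangle (of_nat p / of_nat (q - p))) [(Cross True, 0)]"
      using r0 rational_tangle_lt_one[of ?r] by metis
    have "gcd (q - p) p = gcd q p" using 3 by (simp add: gcd_diff1_nat)
    then have "coprime p (q - p)"
      using less.prems(3) by (simp add: coprime_iff_gcd_eq_1 gcd.commute)
    then have "rat_tangle True p (q - p) (rational_tangle (of_nat p / of_nat (q - p)))"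
      using less.prems 3 by (intro less.hyps) auto
    from rat_tangle.ver[OF this] show ?thesis
      using 3 by (simp add: eq)
  qed
qed

lemma rat_tangle_rational:
  assumes "r > 0"
  obtains p q where "r = of_nat p / of_nat q" "p > 0" "q > 0" "coprime p q"
    "rat_tangle True p q (rational_tangle r)"
    "rat_tangle False p q (rational_tangle (- r))"
proof -
  obtain a b where ab: "r = of_int a / of_int b" "b > 0" "coprime a b"
    by (metis rat_eq_divide)
  have "a > 0" using assms ab by (simp add: zero_less_divide_iff)
  define p where "p = nat a"
  define q where "q = nat b"
  have pq: "r = of_nat p / of_nat q" "p > 0" "q > 0" "coprime p q"
    using ab \<open>a > 0\<close> by (auto simp: p_def q_def coprime_int_iff[symmetric] simp del: coprime_int_iff)
  have "rat_tangle True p q (rational_tangle r)"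
    using rat_tangle_rational_tangle pq by simp
  moreover from this have "rat_tangle False p q (rational_tangle (- r))"
    using rat_tangle_mirror[of True p q "rational_tangle r"] assms
    by (subst rational_tangle.simps) simp
  ultimately show thesis using that pq by blast
qed

lemma rat_tangle_is_tangle: "rat_tangle s p q w \<Longrightarrow> is_tangle 2 w 2"
  by (induction rule: rat_tangle.induct)
    (auto simp: vertical_sum_def intro!: is_tangle_horizontal_sum is_tangle_append[of _ _ 2])

lemma rat_tangle_pos: "rat_tangle s p q w \<Longrightarrow> p > 0 \<and> q > 0"
  by (induction rule: rat_tangle.induct) auto

text \<open>Either sum adds one crossing and replaces \<open>max p q\<close> by
  \<open>p + q\<close>, which is larger by at least 1.\<close>

lemma crossings_rat_tangle: "rat_tangle s p q w \<Longrightarrow> crossings w \<le> max p q"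
proof (induction rule: rat_tangle.induct)
  case one
  then show ?case by simp
next
  case (hor p q w)
  then show ?case using rat_tangle_pos[OF hor.hyps] by (simp add: max_def split: if_splits)
next
  case (ver p q w)
  then show ?case using rat_tangle_pos[OF ver.hyps]
    by (simp add: vertical_sum_def max_def split: if_splits)
qed

section \<open>Colorings of horizontal sums and of rational tangles\<close>

lemma coloring_horizontal_sum:
  assumes "coloring H A [x, z] gs [a1, a2]" "coloring H B [z, y] gs' [b1, b2]" "a2 - b1 \<in> H"
  shows "coloring H (horizontal_sum A B) [x, y] (z # gs @ gs') [a1, b2]"
proof -
  have "coloring H A [x, z, z, y] gs [a1, a2, z, y]"
    using coloring_widen[OF assms(1), of "[z, y]"] by simp
  moreover have "coloring H (shift 2 B) [a1, a2, z, y] gs' [a1, a2, b1, b2]"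
    using coloring_shift[OF assms(2), of "[a1, a2]"] by (simp add: numeral_2_eq_2)
  moreover have "coloring H [(Cap, 1)] [a1, a2, b1, b2] [] [a1, b2]"
    using coloring_cap_iff[of 1 "[a1]" H "[]" a2 b1 "[b2]"] assms(3) by simp
  ultimately have "coloring H (A @ shift 2 B @ [(Cap, 1)]) [x, z, z, y] (gs @ gs' @ []) [a1, b2]"
    by (intro coloring_append)
  then show ?thesis
    using coloring_cup_iff[of 1 "[x]" H _ "[y]"] by (simp add: horizontal_sum_def)
qed

lemma coloring_horizontal_sumE:
  assumes "coloring H (horizontal_sum A B) [x, y] gs vs" "is_tangle 2 A 2" "is_tangle 2 B 2"
  obtains z gs1 gs2 a1 a2 b1 b2 where "gs = z # gs1 @ gs2" "vs = [a1, b2]" "a2 - b1 \<in> H"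
    "coloring H A [x, z] gs1 [a1, a2]" "coloring H B [z, y] gs2 [b1, b2]"
proof -
  have two: "\<exists>c d. ms = [c, d]" if "length ms = 2" for ms :: "'a list"
    using that by (metis (no_types) length_0_conv length_Suc_conv numeral_2_eq_2)
  have "\<exists>z gs'. gs = z # gs' \<and> coloring H (A @ shift 2 B @ [(Cap, 1)]) [x, z, z, y] gs' vs"
    using assms(1) coloring_cup_iff[of 1 "[x]" H _ "[y]"] by (simp add: horizontal_sum_def)
  then obtain z gs' where z: "gs = z # gs'"
    "coloring H (A @ shift 2 B @ [(Cap, 1)]) [x, z, z, y] gs' vs" by blast
  obtain gs1 gs'' ms where A: "gs' = gs1 @ gs''" "coloring H A [x, z, z, y] gs1 ms"
    "coloring H (shift 2 B @ [(Cap, 1)]) ms gs'' vs"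
    using z(2) by (rule coloring_appendE)
  obtain gs2 gs3 ns where B: "gs'' = gs2 @ gs3" "coloring H (shift 2 B) ms gs2 ns"
    "coloring H [(Cap, 1)] ns gs3 vs"
    using A(3) by (rule coloring_appendE)
  have "\<exists>ms'. ms = ms' @ [z, y] \<and> coloring H A [x, z] gs1 ms' \<and> length ms' = 2"
    using coloring_shift_widenD[of H "[]" A "[x, z]" "[z, y]" gs1 ms 2] A(2) assms(2)
    by (auto simp: numeral_2_eq_2)
  then obtain a1 a2 where a: "ms = [a1, a2, z, y]" "coloring H A [x, z] gs1 [a1, a2]"
    using two by fastforce
  have "\<exists>ns'. ns = [a1, a2] @ ns' \<and> coloring H B [z, y] gs2 ns' \<and> length ns' = 2"
    using coloring_shift_widenD[of H "[a1, a2]" B "[z, y]" "[]" gs2 ns 2] B(2) assms(3)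
    by (auto simp: a(1) numeral_2_eq_2)
  then obtain b1 b2 where b: "ns = [a1, a2, b1, b2]" "coloring H B [z, y] gs2 [b1, b2]"
    using two by fastforce
  have "a2 - b1 \<in> H \<and> gs3 = [] \<and> vs = [a1, b2]"
    using coloring_cap_iff[of 1 "[a1]" H "[]" a2 b1 "[b2]"] B(3) by (simp add: b(1))
  then show thesis
    by (intro that[of z gs1 gs2 a1 b2 a2 b1]) (use z(1) A(1) B(1) a(2) b(2) in auto)
qed

text \<open>The colors of \<open>T(p / q)\<close> are determined by the color of its lower left end and by a
  parameter \<open>t\<close>: going right they change by \<open>- p t\<close>, going up by \<open>q t\<close>.\<close>

definition crossing_sign :: "bool \<Rightarrow> 'a :: comm_ring_1" where
  "crossing_sign s = (if s then 1 else - 1)"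

text \<open>The case of slope 1 or -1. Modulo \<open>H\<close>, the lower right color is x - t for
  \<open>Cross True\<close> and x + t for \<open>Cross False\<close>; the upper left color is then
  2x - y or y, hence x + t in both cases.\<close>

lemma cross_coloring:
  assumes H: "add_subgroup H" and bottom: "y - x + crossing_sign s * t \<in> H"
  shows "\<exists>gs x' y'. coloring H [(Cross s, 0)] [x, y] gs [x', y'] \<and>
    x' - x - t \<in> H \<and> y' - x' + crossing_sign s * t \<in> H"
proof (cases s)
  case True
  have "coloring H [(Cross True, 0)] [x, y] [2 * x - y] [2 * x - y, x]"
    using coloring_cross_true_iff[of 0 "[]" H "[]" x y "[]"] add_subgroup_zero[OF H] by simp
  moreover have "2 * x - y - x - t = - (y - x + crossing_sign s * t)" "x - (2 * x - y) + crossing_sign s * t = y - x + crossing_sign s * t"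
    by (simp_all add: True crossing_sign_def)
  ultimately show ?thesis
    using bottom add_subgroup_uminus[OF H bottom] True by metis
next
  case False
  have "coloring H [(Cross False, 0)] [x, y] [2 * y - x] [y, 2 * y - x]"
    using coloring_cross_false_iff[of 0 "[]" H "[]" x y "[]"] add_subgroup_zero[OF H] by simp
  moreover have "y - x - t = y - x + crossing_sign s * t" "2 * y - x - y + crossing_sign s * t = y - x + crossing_sign s * t"
    by (simp_all add: False crossing_sign_def)
  ultimately show ?thesis
    using bottom False by (metis (full_types))
qed

text \<open>Side by side, tangles have a common height and their widths add up; stacked, they have a
  common width and their heights add up. This matches the passage from (p, q) to (p + q, q) and to
  (p, p + q).\<close>

lemma rat_tangle_coloring:
  assumes "rat_tangle s p q w" and H: "add_subgroup H"
    and "y - x + crossing_sign s * of_nat p * t \<in> H"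
  shows "\<exists>gs x' y'. coloring H w [x, y] gs [x', y'] \<and>
    x' - x - of_nat q * t \<in> H \<and> y' - x' + crossing_sign s * of_nat p * t \<in> H"
  using assms(1,3)
proof (induction arbitrary: x y rule: rat_tangle.induct)
  case one
  then show ?case using cross_coloring[OF H, of y x s t] by simp
next
  case (hor p q w)
  define z where "z = x - crossing_sign s * of_nat p * t"
  have "z - x + crossing_sign s * of_nat p * t \<in> H"
    by (simp add: z_def add_subgroup_zero[OF H])
  from hor.IH[OF this] obtain gs a1 a2 where A: "coloring H w [x, z] gs [a1, a2]"
    "a1 - x - of_nat q * t \<in> H" "a2 - a1 + crossing_sign s * of_nat p * t \<in> H"
    by blast
  \<comment> \<open>The new crossing gets the parameter \<open>q t\<close>, so that it is as high as
    \<open>w\<close> and the inner upper ends can be joined.\<close>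
  have "y - z + crossing_sign s * (of_nat q * t) \<in> H"
    using hor.prems by (simp add: z_def algebra_simps)
  from cross_coloring[OF H this] obtain gs' b1 b2 where
    B: "coloring H [(Cross s, 0)] [z, y] gs' [b1, b2]"
    "b1 - z - of_nat q * t \<in> H" "b2 - b1 + crossing_sign s * (of_nat q * t) \<in> H"
    by blast
  have cap: "a2 - b1 \<in> H"
    using add_subgroup_diff[OF H add_subgroup_add[OF H A(2,3)] B(2)] by (simp add: z_def algebra_simps)
  have "b2 - a1 + crossing_sign s * of_nat (p + q) * t \<in> H"
    using add_subgroup_diff[OF H add_subgroup_add[OF H A(3) B(3)] cap] by (simp add: algebra_simps)
  with coloring_horizontal_sum[OF A(1) B(1) cap] A(2) show ?case by blast
next
  case (ver p q w)
  from ver.IH[OF ver.prems] obtain gs a1 a2 where A: "coloring H w [x, y] gs [a1, a2]"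
    "a1 - x - of_nat q * t \<in> H" "a2 - a1 + crossing_sign s * of_nat p * t \<in> H"
    by blast
  \<comment> \<open>Here the new crossing gets the parameter \<open>p t\<close>, so that it is as
    wide as \<open>w\<close>.\<close>
  have "a2 - a1 + crossing_sign s * (of_nat p * t) \<in> H"
    using A(3) by (simp add: mult.assoc)
  from cross_coloring[OF H this] obtain gs' b1 b2 where
    B: "coloring H [(Cross s, 0)] [a1, a2] gs' [b1, b2]"
    "b1 - a1 - of_nat p * t \<in> H" "b2 - b1 + crossing_sign s * (of_nat p * t) \<in> H"
    by blast
  have "b1 - x - of_nat (p + q) * t \<in> H"
    using add_subgroup_add[OF H A(2) B(2)] by (simp add: algebra_simps)
  with coloring_append[OF A(1) B(1)] B(3) show ?case
    by (auto simp: vertical_sum_def mult.assoc)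
qed

lemma cross_rigid:
  assumes "coloring {0 :: int} [(Cross s, 0)] [x, y] gs [x', y']"
  shows "y - x + crossing_sign s * (x' - x) = 0" "y = x \<Longrightarrow> set gs \<subseteq> {x}"
  using assms coloring_cross_true_iff[of 0 "[]" "{0}" "[]" x y "[]" gs "[x', y']"]
    coloring_cross_false_iff[of 0 "[]" "{0}" "[]" x y "[]" gs "[x', y']"]
  by (cases s; auto simp: crossing_sign_def)+

lemma coloring_width:
  assumes "coloring {0 :: int} w [x, y] gs [x', y']"
  shows "y' - x' = y - x"
  using coloring_alternating_sum[OF assms] by simp

text \<open>A converse to \<open>rat_tangle_coloring\<close> over the integers: eliminating t from
  the width and the height leaves one linear equation, and a coloring of width and height 0 is
  constant.\<close>

lemma rat_tangle_rigid:
  assumes "rat_tangle s p q w" "coloring {0 :: int} w [x, y] gs [x', y']"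
  shows "int q * (y - x) + crossing_sign s * int p * (x' - x) = 0 \<and> (y = x \<and> x' = x \<longrightarrow> set gs \<subseteq> {x})"
  using assms
proof (induction arbitrary: x y gs x' y' rule: rat_tangle.induct)
  case one
  then show ?case using cross_rigid[OF one.prems] by auto
next
  case (hor p q w)
  have "is_tangle 2 [(Cross s, 0)] 2" by simp
  with hor.prems rat_tangle_is_tangle[OF hor.hyps]
  obtain z gs1 gs2 a2 b1 where gs: "gs = z # gs1 @ gs2" and cap: "a2 = b1"
    and A: "coloring {0} w [x, z] gs1 [x', a2]"
    and B: "coloring {0} [(Cross s, 0)] [z, y] gs2 [b1, y']"
    by (elim coloring_horizontal_sumE) auto
  note IH = hor.IH[OF A] and cross = cross_rigid[OF B]
  \<comment> \<open>Lower and upper width of \<open>w\<close> agree, so the two summands have the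
    same height.\<close>
  have h: "b1 - z = x' - x" using coloring_width[OF A] cap by simp
  have "int (p + q) * (x' - x) * crossing_sign s + int q * (y - x) =
      (int q * (z - x) + crossing_sign s * int p * (x' - x)) + int q * (y - z + crossing_sign s * (b1 - z))"
    unfolding h by (simp add: algebra_simps)
  also have "\<dots> = 0" using IH cross(1) by simp
  finally have 1: "int q * (y - x) + crossing_sign s * int (p + q) * (x' - x) = 0"
    by (simp add: algebra_simps)
  moreover have "set gs \<subseteq> {x}" if "y = x" "x' = x"
  proof -
    have "z = x" using cross(1) h that by simp
    then show ?thesis using IH cross(2) that gs by auto
  qed
  ultimately show ?case by blast
next
  case (ver p q w)
  from ver.prems obtain gs1 gs2 ms where gs: "gs = gs1 @ gs2"
    and A': "coloring {0} w [x, y] gs1 ms" and B': "coloring {0} [(Cross s, 0)] ms gs2 [x', y']"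
    unfolding vertical_sum_def by (rule coloring_appendE)
  have "length ms = 2"
    using coloring_tangle_length[OF A'] rat_tangle_is_tangle[OF ver.hyps] by (simp add: numeral_2_eq_2)
  then obtain a1 a2 where ms: "ms = [a1, a2]"
    by (metis (no_types) length_0_conv length_Suc_conv numeral_2_eq_2)
  note A = A'[unfolded ms] and B = B'[unfolded ms]
  note IH = ver.IH[OF A] and cross = cross_rigid[OF B]
  have w: "a2 - a1 = y - x" using coloring_width[OF A] .
  have "int (p + q) * (y - x) + crossing_sign s * int p * (x' - x) =
      (int q * (y - x) + crossing_sign s * int p * (a1 - x)) + int p * (a2 - a1 + crossing_sign s * (x' - a1))"
    unfolding w by (simp add: algebra_simps)
  also have "\<dots> = 0" using IH cross(1) by simp
  finally have "int (p + q) * (y - x) + crossing_sign s * int p * (x' - x) = 0" .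
  moreover have "set gs \<subseteq> {x}" if "y = x" "x' = x"
  proof -
    have "a1 = a2" "crossing_sign s * (x' - a1) = 0" using w cross(1) that by auto
    then have "a1 = x" using that(2) by (simp add: crossing_sign_def split: if_splits)
    then show ?thesis using IH cross(2) that gs \<open>a1 = a2\<close> by auto
  qed
  ultimately show ?case by blast
qed

section \<open>Montesinos links\<close>

lemma add_subgroup_coprime:
  fixes t :: "'a :: comm_ring_1"
  assumes "add_subgroup S" "of_nat p * t \<in> S" "of_nat q * t \<in> S" "coprime p q"
  shows "t \<in> S"
proof -
  obtain a b where "a * int p + b * int q = 1"
    using bezout_int[of "int p" "int q"] assms(4) by auto
  then have "t = of_int (a * int p + b * int q) * t" by simp
  also have "\<dots> = of_int a * (of_nat p * t) + of_int b * (of_nat q * t)"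
    by (simp add: algebra_simps)
  also have "\<dots> \<in> S"
    using assms by (intro add_subgroup_add add_subgroup_of_int_mult)
  finally show ?thesis .
qed

text \<open>Modulo \<open>H\<close>, p t up to sign and q t are differences of colors of the tangle,
  so both lie in \<open>S\<close>; coprimality then yields t.\<close>

lemma coloring_generates_parameter:
  assumes S: "add_subgroup S" "H \<subseteq> S" and "coloring H w [x, y] gs [x', y']"
    and "x \<in> S" "y \<in> S" "set gs \<subseteq> S" "coprime p q"
    and "x' - x - of_nat q * t \<in> H" "y - x + crossing_sign s * of_nat p * t \<in> H"
  shows "t \<in> S"
proof (rule add_subgroup_coprime[OF S(1)])
  have x': "x' \<in> S" using coloring_in_gens[OF assms(3)] assms(4-6) by auto
  have "x' - x \<in> S" "x' - x - of_nat q * t \<in> S"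
    using add_subgroup_diff[OF S(1) x' assms(4)] S(2) assms(8) by auto
  from add_subgroup_diff[OF S(1) this] show "of_nat q * t \<in> S" by simp
  have "y - x + crossing_sign s * of_nat p * t \<in> S" "y - x \<in> S"
    using add_subgroup_diff[OF S(1) assms(5,4)] S(2) assms(9) by auto
  from add_subgroup_diff[OF S(1) this] have "crossing_sign s * of_nat p * t \<in> S" by simp
  then show "of_nat p * t \<in> S"
    using add_subgroup_uminus[OF S(1), of "- (of_nat p * t)"]
    by (cases s) (auto simp: crossing_sign_def)
qed (use assms in \<open>auto simp: coprime_commute\<close>)

text \<open>Tangles with parameters t0, t1, t2 fit together if their heights agree, which are the
  first two relations, and if their widths add up to 0, which is the third. The width of
  \<open>B\<close> has the opposite sign because \<open>B\<close> is built from negative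
  crossings.\<close>

lemma montesinos_coloring:
  fixes H :: "'a :: comm_ring_1 set"
  assumes H: "add_subgroup H"
    and A: "rat_tangle True p q A" "coprime p q"
    and R: "rat_tangle True u v R" "coprime u v"
    and B: "rat_tangle False P Q B" "coprime P Q"
    and rel: "of_nat q * t0 - of_nat v * t1 \<in> H" "of_nat v * t1 - of_nat Q * t2 \<in> H"
      "of_nat p * t0 + of_nat u * t1 - of_nat P * t2 \<in> H"
  shows "\<exists>gs vs. coloring H ([(Cup, 0)] @ horizontal_sum (horizontal_sum A R) B) [] (0 # gs) vs \<and>
    (\<forall>S. add_subgroup S \<longrightarrow> H \<subseteq> S \<longrightarrow> set gs \<subseteq> S \<longrightarrow> t0 \<in> S \<and> t1 \<in> S \<and> t2 \<in> S)"
proof -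
  \<comment> \<open>The lower ends have the colors 0, y, z, 0 from left to right: the outer two
    belong to the closing cup, and y and z are forced by the widths of \<open>A\<close> and
    \<open>R\<close>.\<close>
  define y where "y = - (of_nat p * t0)"
  define z where "z = y - of_nat u * t1"
  have bottoms: "y - 0 + crossing_sign True * of_nat p * t0 \<in> H"
    "z - y + crossing_sign True * of_nat u * t1 \<in> H"
    "0 - z + crossing_sign False * of_nat P * t2 \<in> H"
    using add_subgroup_zero[OF H] rel(3) by (simp_all add: y_def z_def crossing_sign_def add.commute)
  from rat_tangle_coloring[OF A(1) H bottoms(1)] obtain gs1 a1 a2 where
    cA: "coloring H A [0, y] gs1 [a1, a2]" "a1 - 0 - of_nat q * t0 \<in> H"
      "a2 - a1 + crossing_sign True * of_nat p * t0 \<in> H"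
    by blast
  from rat_tangle_coloring[OF R(1) H bottoms(2)] obtain gs2 r1 r2 where
    cR: "coloring H R [y, z] gs2 [r1, r2]" "r1 - y - of_nat v * t1 \<in> H"
      "r2 - r1 + crossing_sign True * of_nat u * t1 \<in> H"
    by blast
  from rat_tangle_coloring[OF B(1) H bottoms(3)] obtain gs3 b1 b2 where
    cB: "coloring H B [z, 0] gs3 [b1, b2]" "b1 - z - of_nat Q * t2 \<in> H"
      "b2 - b1 + crossing_sign False * of_nat P * t2 \<in> H"
    by blast
  have "a2 - r1 \<in> H"
    using add_subgroup_diff[OF H add_subgroup_add[OF H add_subgroup_add[OF H cA(2,3)] rel(1)] cR(2)]
    by (simp add: y_def crossing_sign_def algebra_simps)
  note AR = coloring_horizontal_sum[OF cA(1) cR(1) this]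
  have "r2 - b1 \<in> H"
    using add_subgroup_diff[OF H add_subgroup_add[OF H add_subgroup_add[OF H cR(2,3)] rel(2)] cB(2)]
    by (simp add: z_def crossing_sign_def algebra_simps)
  note ARB = coloring_horizontal_sum[OF AR cB(1) this]
  define gs where "gs = z # (y # gs1 @ gs2) @ gs3"
  have "coloring H ([(Cup, 0)] @ horizontal_sum (horizontal_sum A R) B) [] (0 # gs) [a1, b2]"
    using ARB coloring_cup_iff[of 0 "[]" H _ "[]"] by (simp add: gs_def)
  moreover have "t0 \<in> S \<and> t1 \<in> S \<and> t2 \<in> S" if S: "add_subgroup S" "H \<subseteq> S" "set gs \<subseteq> S" for S
  proof (intro conjI)
    have mem: "0 \<in> S" "y \<in> S" "z \<in> S" "set gs1 \<subseteq> S" "set gs2 \<subseteq> S" "set gs3 \<subseteq> S"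
      using S(3) add_subgroup_zero[OF S(1)] by (auto simp: gs_def)
    show "t0 \<in> S"
      by (rule coloring_generates_parameter[OF S(1,2) cA(1) mem(1,2,4) A(2) cA(2) bottoms(1)])
    show "t1 \<in> S"
      by (rule coloring_generates_parameter[OF S(1,2) cR(1) mem(2,3,5) R(2) cR(2) bottoms(2)])
    show "t2 \<in> S"
      by (rule coloring_generates_parameter[OF S(1,2) cB(1) mem(3,1,6) B(2) cB(2) bottoms(3)])
  qed
  ultimately show ?thesis by blast
qed

text \<open>The three tangles share one height \<open>a1\<close>, and their widths are
  \<open>a1\<close> times minus the slopes. The widths add up to 0 while the sum of the slopes is
  positive, so \<open>a1\<close> vanishes, and with it every color.\<close>

lemma montesinos_rigid:
  assumes A: "rat_tangle True p q A" and R: "rat_tangle True u v R" and B: "rat_tangle False P Q B"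
    and pos: "q * P < p * Q"
    and col: "coloring {0 :: int} ([(Cup, 0)] @ horizontal_sum (horizontal_sum A R) B) [] (0 # gs) vs"
  shows "set gs \<subseteq> {0}"
proof -
  note tangles = A[THEN rat_tangle_is_tangle] R[THEN rat_tangle_is_tangle] B[THEN rat_tangle_is_tangle]
  have "coloring {0} (horizontal_sum (horizontal_sum A R) B) [0, 0] gs vs"
    using col coloring_cup_iff[of 0 "[]" "{0}" "horizontal_sum (horizontal_sum A R) B" "[]" "0 # gs" vs]
    by auto
  moreover have "is_tangle 2 (horizontal_sum A R) 2"
    using tangles by (intro is_tangle_horizontal_sum)
  ultimately obtain z gs' gs3 a1 r2 b1 b2 where gs: "gs = z # gs' @ gs3" "vs = [a1, b2]" "r2 - b1 \<in> {0}"
    and AR: "coloring {0} (horizontal_sum A R) [0, z] gs' [a1, r2]"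
    and cB: "coloring {0} B [z, 0] gs3 [b1, b2]"
    by (rule coloring_horizontal_sumE[OF _ _ tangles(3)]) (use that in blast)
  obtain y gs1 gs2 a1' a2 r1 r2' where gs': "gs' = y # gs1 @ gs2" "[a1, r2] = [a1', r2']" "a2 - r1 \<in> {0}"
    and "coloring {0} A [0, y] gs1 [a1', a2]" "coloring {0} R [y, z] gs2 [r1, r2']"
    by (rule coloring_horizontal_sumE[OF AR tangles(1,2)]) (use that in blast)
  then have cA: "coloring {0} A [0, y] gs1 [a1, a2]" and cR: "coloring {0} R [y, z] gs2 [r1, r2]"
    by auto
  have h: "r1 - y = a1" "b1 - z = a1"
    using coloring_width[OF cA] coloring_width[OF cR] gs(3) gs'(3) by auto
  note rigid = rat_tangle_rigid[OF A cA] rat_tangle_rigid[OF R cR] rat_tangle_rigid[OF B cB]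
  have eqs: "int q * y = - (int p * a1)" "int v * (z - y) = - (int u * a1)" "int Q * z = - (int P * a1)"
    using rigid h by (auto simp: crossing_sign_def)
  have pos': "p > 0" "q > 0" "u > 0" "v > 0" "P > 0" "Q > 0"
    using A R B rat_tangle_pos by blast+
  have "a1 * (int v * (int p * int Q - int q * int P) + int u * int q * int Q) =
      - (int v * int Q) * (int q * y) - int q * int Q * (int v * (z - y)) + int q * int v * (int Q * z)"
    unfolding eqs by (simp add: algebra_simps)
  also have "\<dots> = 0" by (simp add: algebra_simps)
  finally have "a1 * (int v * (int p * int Q - int q * int P) + int u * int q * int Q) = 0" .
  moreover have "int q * int P < int p * int Q"
    using pos by (metis of_nat_less_iff of_nat_mult)
  then have "int v * (int p * int Q - int q * int P) + int u * int q * int Q > 0"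
    using pos' by (intro add_pos_pos mult_pos_pos) auto
  ultimately have "a1 = 0" by simp
  then have "y = 0" "z = 0" using eqs pos' by auto
  with rigid h \<open>a1 = 0\<close> show ?thesis
    by (auto simp: gs(1) gs'(1))
qed

section \<open>The matrix of the three parameters and the lower bound for det(L)\<close>

lemma det_2:
  assumes "A \<in> carrier_mat 2 2"
  shows "det A = A $$ (0, 0) * A $$ (1, 1) - A $$ (0, 1) * A $$ (1, 0)"
proof -
  have "det (mat_delete A 0 j) = A $$ (1, 1 - j)" if "j < 2" for j
  proof -
    have "mat_delete A 0 j \<in> carrier_mat 1 1"
      using assms by (auto simp: mat_delete_def)
    then show ?thesis
      using assms that by (subst det_single) (auto simp: mat_delete_def)
  qed
  then show ?thesis
    using laplace_expansion_row[OF assms, of 0] by (simp add: cofactor_def numeral_2_eq_2)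
qed

lemma det_3:
  assumes "A \<in> carrier_mat 3 3"
  shows "det A = A $$ (0, 0) * (A $$ (1, 1) * A $$ (2, 2) - A $$ (1, 2) * A $$ (2, 1))
    - A $$ (0, 1) * (A $$ (1, 0) * A $$ (2, 2) - A $$ (1, 2) * A $$ (2, 0))
    + A $$ (0, 2) * (A $$ (1, 0) * A $$ (2, 1) - A $$ (1, 1) * A $$ (2, 0))"
proof -
  have "mat_delete A 0 j \<in> carrier_mat 2 2" for j
    using assms by (auto simp: mat_delete_def)
  note minor = det_2[OF this]
  have "det (mat_delete A 0 0) = A $$ (1, 1) * A $$ (2, 2) - A $$ (1, 2) * A $$ (2, 1)"
    "det (mat_delete A 0 1) = A $$ (1, 0) * A $$ (2, 2) - A $$ (1, 2) * A $$ (2, 0)"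
    "det (mat_delete A 0 2) = A $$ (1, 0) * A $$ (2, 1) - A $$ (1, 1) * A $$ (2, 0)"
    using assms unfolding minor by (simp_all add: mat_delete_def numeral_2_eq_2)
  then show ?thesis
    using laplace_expansion_row[OF assms, of 0]
    by (simp add: cofactor_def numeral_3_eq_3 numeral_2_eq_2 right_diff_distrib)
qed

text \<open>In terms of the parameters of the three tangles, the first two rows say that their heights
  agree, and the third one that their widths add up to zero.\<close>

definition montesinos_matrix :: "nat \<Rightarrow> nat \<Rightarrow> nat \<Rightarrow> nat \<Rightarrow> nat \<Rightarrow> nat \<Rightarrow> int mat" where
  "montesinos_matrix p q u v P Q = mat 3 3 (\<lambda>(i, j).
    [[int q, - int v, 0], [0, int v, - int Q], [int p, int u, - int P]] ! i ! j)"

text \<open>The value is q v Q (p/q + u/v - P/Q), the expression in the determinant formula for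
  Montesinos links.\<close>

lemma det_montesinos_matrix:
  "det (montesinos_matrix p q u v P Q) =
    int v * (int p * int Q - int q * int P) + int u * int q * int Q"
proof -
  have "montesinos_matrix p q u v P Q \<in> carrier_mat 3 3"
    by (simp add: montesinos_matrix_def)
  from det_3[OF this] show ?thesis
    by (simp add: montesinos_matrix_def algebra_simps)
qed

lemma row_span_3:
  fixes E :: "int mat"
  assumes "i < 3"
  shows "(\<Sum>j<3. of_int (E $$ (i, j)) * monom 1 j) \<in> row_span 3 E"
proof -
  have "coeff (\<Sum>j<3. of_int (E $$ (i, j)) * monom 1 j) l =
      (\<Sum>m<3. (if m = i then 1 else 0) * E $$ (m, l))" if "l < 3" for l
  proof -
    have "coeff (\<Sum>j<3. of_int (E $$ (i, j)) * monom 1 j) l =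
        (\<Sum>j<3. if j = l then E $$ (i, j) else 0)"
      by (simp add: coeff_sum of_int_poly if_distrib cong: if_cong)
    also have "\<dots> = E $$ (i, l)" using that by simp
    also have "\<dots> = (\<Sum>m<3. if m = i then E $$ (m, l) else 0)" using assms by simp
    finally show ?thesis by (simp add: if_distrib[where f = "\<lambda>x. x * _"] cong: if_cong)
  qed
  then show ?thesis
    unfolding row_span_def
    by (intro CollectI exI[of _ "\<lambda>m. if m = i then 1 else 0"] allI impI)
qed

lemma link_det_montesinos:
  assumes A: "rat_tangle True p q A" "coprime p q"
    and R: "rat_tangle True u v R" "coprime u v"
    and B: "rat_tangle False P Q B" "coprime P Q"
    and pos: "q * P < p * Q"
  shows "int v * (int p * int Q - int q * int P) + int u * int q * int Q
    \<le> link_det (montesinos A R B)"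
proof -
  let ?w = "[(Cup, 0)] @ horizontal_sum (horizontal_sum A R) B"
  let ?E = "montesinos_matrix p q u v P Q"
  have L: "montesinos A R B = ?w @ [(Cap, 0)]"
    by (simp add: montesinos_def numerator_closure_def)
  have "is_tangle 2 (horizontal_sum (horizontal_sum A R) B) 2"
    using A R B rat_tangle_is_tangle by (intro is_tangle_horizontal_sum) auto
  then have w: "is_tangle 0 ?w 2" by (simp add: numeral_2_eq_2)
  have E: "?E \<in> carrier_mat 3 3" by (simp add: montesinos_matrix_def)
  \<comment> \<open>The universal parameters are the unit vectors of \<int>^3, represented by
    monomials; the rows of \<open>?E\<close> are the relations demanded by
    \<open>montesinos_coloring\<close>.\<close>
  have rel: "of_nat q * monom 1 0 - of_nat v * monom 1 1 \<in> row_span 3 ?E"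
    "of_nat v * monom 1 1 - of_nat Q * monom 1 2 \<in> row_span 3 ?E"
    "of_nat p * monom 1 0 + of_nat u * monom 1 1 - of_nat P * monom 1 2 \<in> row_span 3 ?E"
    using row_span_3[of 0 ?E] row_span_3[of 1 ?E] row_span_3[of 2 ?E]
    by (simp_all add: montesinos_matrix_def numeral_3_eq_3 numeral_2_eq_2)
  obtain gs vs where gs: "coloring (row_span 3 ?E) ?w [] (0 # gs) vs"
    and gen: "\<And>S. add_subgroup S \<Longrightarrow> row_span 3 ?E \<subseteq> S \<Longrightarrow> set gs \<subseteq> S \<Longrightarrow>
      monom 1 0 \<in> S \<and> monom 1 1 \<in> S \<and> monom 1 2 \<in> S"
    using montesinos_coloring[OF add_subgroup_row_span A R B rel] by blast
  have "det ?E dvd link_det (?w @ [(Cap, 0)])"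
  proof (rule det_dvd_link_det[OF w E gs])
    fix S and j :: nat
    assume "add_subgroup S" "row_span 3 ?E \<subseteq> S" "set gs \<subseteq> S" "j < 3"
    moreover from \<open>j < 3\<close> have "j = 0 \<or> j = 1 \<or> j = 2" by auto
    ultimately show "monom 1 j \<in> S" using gen by blast
  qed
  moreover have "link_det (?w @ [(Cap, 0)]) \<noteq> 0"
    by (rule link_det_nonzero[OF w]) (rule montesinos_rigid[OF A(1) R(1) B(1) pos])
  ultimately have "\<bar>det ?E\<bar> \<le> \<bar>link_det (montesinos A R B)\<bar>"
    unfolding L by (intro dvd_imp_le_int)
  then show ?thesis
    by (simp add: det_montesinos_matrix link_det_def)
qed

text \<open>A slope p/q strictly between 0 and 1 ensures both max p q = q and q \<ge> 2, as the
  final estimate requires.\<close>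

lemma conway_slope_bounds:
  assumes "a1 > 0" "a2 > 0" "a3 > 0"
  shows "0 < conway_slope a1 a2 a3" "conway_slope a1 a2 a3 < 1"
proof -
  have "1 * (1 + a1 * a2) \<le> a3 * (1 + a1 * a2)"
    using assms by (intro mult_right_mono) auto
  then have "1 + a1 * a2 < a1 + a3 + a1 * a2 * a3"
    using assms by (simp add: algebra_simps)
  then have "rat_of_nat (1 + a1 * a2) < rat_of_nat (a1 + a3 + a1 * a2 * a3)"
    by (rule of_nat_less_iff[THEN iffD2])
  moreover have "rat_of_nat (1 + a1 * a2) > 0"
    unfolding of_nat_0_less_iff by simp
  ultimately show "0 < conway_slope a1 a2 a3" "conway_slope a1 a2 a3 < 1"
    unfolding conway_slope_eq[OF assms] by (auto simp only: zero_less_divide_iff divide_less_eq_1)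
qed

lemma crossing_number_le: "crossing_number D \<le> crossings D"
  unfolding crossing_number_def by (intro Least_le exI[of _ D]) (simp add: isotopic_def)

text \<open>The integer pQ - qP is at least 1, so the first term is at least v. As q, Q \<ge> 2 give
  qQ \<ge> q + Q, the second is at least qQ - 1 + u. Finally max u v \<le> u + v - 1.\<close>

lemma crossings_le_det:
  fixes p q u v P Q :: nat
  assumes "q \<ge> 2" "Q \<ge> 2" "u > 0" "v > 0" "q * P < p * Q"
  shows "int (q + max u v + Q) \<le> int v * (int p * int Q - int q * int P) + int u * int q * int Q"
proof -
  have "int q * int P < int p * int Q"
    using assms(5) by (metis of_nat_less_iff of_nat_mult)
  then have v: "int v * 1 \<le> int v * (int p * int Q - int q * int P)"
    by (intro mult_left_mono) auto
  have "1 * 1 \<le> (int q - 1) * (int Q - 1)"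
    using assms by (intro mult_mono) auto
  then have qQ: "int q + int Q \<le> int q * int Q" by (simp add: algebra_simps)
  have "1 * (int q * int Q - 1) \<le> int u * (int q * int Q - 1)"
    using qQ assms by (intro mult_right_mono) auto
  then have u: "int q * int Q - 1 + int u \<le> int u * int q * int Q" by (simp add: algebra_simps)
  have "int (q + max u v + Q) \<le> int q + int Q + (int u + int v - 1)"
    using assms(3,4) by (simp add: max_def)
  with v u qQ show ?thesis by linarith
qed

theorem theorem2p12:
  fixes a1 a2 a3 c1 c2 c3 :: nat and r :: rat and L :: diagram
  assumes "a1 > 0" "a2 > 0" "a3 > 0" "c1 > 0" "c2 > 0" "c3 > 0"
    and "(of_nat (1 + a1 * a2) / of_nat (1 + c1 * c2) :: rat) >
      of_nat (a1 + a3 + a1 * a2 * a3) / of_nat (c1 + c3 + c1 * c2 * c3)"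
    and "r > 0"
    and "L = montesinos (rational_tangle (conway_slope a1 a2 a3)) (rational_tangle r)
      (rational_tangle (- conway_slope c1 c2 c3))"
  shows "int (crossing_number L) \<le> link_det L"
proof -
  note bounds = conway_slope_bounds[OF assms(1-3)] conway_slope_bounds[OF assms(4-6)]
  obtain p q where A: "conway_slope a1 a2 a3 = of_nat p / of_nat q" "q > 0" "coprime p q"
      "rat_tangle True p q (rational_tangle (conway_slope a1 a2 a3))" "p > 0"
    using rat_tangle_rational[OF bounds(1)] by metis
  obtain u v where R: "u > 0" "v > 0" "coprime u v" "rat_tangle True u v (rational_tangle r)"
    using rat_tangle_rational[OF assms(8)] by metis
  obtain P Q where B: "conway_slope c1 c2 c3 = of_nat P / of_nat Q" "Q > 0" "coprime P Q"
      "rat_tangle False P Q (rational_tangle (- conway_slope c1 c2 c3))" "P > 0"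
    using rat_tangle_rational[OF bounds(3)] by metis
  have lt: "p < q" "P < Q"
    using bounds(2,4) A(1,2) B(1,2) by (simp_all add: divide_less_eq)
  have "conway_slope c1 c2 c3 < conway_slope a1 a2 a3"
  proof -
    \<comment> \<open>The hypothesis compares a ratio of numerators with a ratio of denominators;
      rearranged, it compares the two slopes.\<close>
    have cross: "n / d > n' / d'" if "n / n' > d / d'" "n' > 0" "d > 0" "d' > 0" for n d n' d' :: rat
      using that by (simp add: field_simps)
    have "rat_of_nat (1 + c1 * c2) > 0" "rat_of_nat (a1 + a3 + a1 * a2 * a3) > 0"
      "rat_of_nat (c1 + c3 + c1 * c2 * c3) > 0"
      unfolding of_nat_0_less_iff using assms(1-6) by auto
    from cross[OF assms(7) this] show ?thesis
      unfolding conway_slope_eq[OF assms(1-3)] conway_slope_eq[OF assms(4-6)] .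
  qed
  then have "rat_of_nat P * rat_of_nat q < rat_of_nat p * rat_of_nat Q"
    using A(1,2) B(1,2) by (simp add: field_simps)
  then have pos: "q * P < p * Q"
    by (metis mult.commute of_nat_less_iff of_nat_mult)
  have "crossings L \<le> q + max u v + Q"
    using crossings_rat_tangle[OF A(4)] crossings_rat_tangle[OF R(4)] crossings_rat_tangle[OF B(4)] lt
    by (simp add: assms(9) montesinos_def numerator_closure_def)
  with crossing_number_le[of L] have "int (crossing_number L) \<le> int (q + max u v + Q)"
    by linarith
  also have "\<dots> \<le> int v * (int p * int Q - int q * int P) + int u * int q * int Q"
    using lt A(5) B(5) R(1,2) pos by (intro crossings_le_det) auto
  also have "\<dots> \<le> link_det L"
    unfolding assms(9) by (rule link_det_montesinos[OF A(4,3) R(4,3) B(4,3) pos])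
  finally show ?thesis .
qed

end
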